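(* Let $F$ be a number field and let $S$ be any set of real places of $F$. Then there is a canonical bijection $$\mathrm{Cl}_S(F)\xrightarrow{\ \sim\ }\mathrm{Pic}^{\mathrm{refl}}(\mathcal{O}_{F_+}),$$ namely the map sending the class of a fractional ideal $I$ to the isomorphism class of the $\mathcal{O}_{F_+}$-module $I_+=\{\alpha\in I\mid \sigma(\alpha)\ge 0\text{ for all }\sigma\in S\}$.
   Context: Real places of $F$ are identified with field embeddings $\sigma:F\to\mathbb{R}$. $\mathrm{Cl}_S(F)$ denotes the quotient of the group of (nonzero) fractional ideals of $F$ (with respect to its ring of algebraic integers) by the subgroup of principal fractional ideals $(\beta)$, where $\beta\in F^\times$ satisfies $\sigma(\beta)\geq 0$ for all $\sigma\in S$. $\mathcal{O}_{F_+}$ denotes the subsemiring of $F$ consisting of the algebraic integers $\alpha\in F$ with $\sigma(\alpha)\ge 0$ for all $\sigma\in S$. Semirings are commutative (with $0$ and $1$, and $x\cdot 0=0$). A module over a semiring $A$ is a commutative monoid with a bilinear action of the multiplicative monoid of $A$; $\otimes_A$ is the tensor product representing $A$-bilinear maps. The dual of an $A$-module $L$ is $L^\vee=\mathrm{Hom}_A(L,A)$. $L$ is reflexive if the canonical map $L\to L^{\vee\vee}$, $\ell\mapsto(\chi\mapsto\chi(\ell))$, is an isomorphism. An $\mathcal{O}_{F_+}$-module $L$ is of rank $1$ if $F\otimes_{\mathcal{O}_{F_+}}L$ is a $1$-dimensional $F$-vector space. $\mathrm{Pic}^{\mathrm{refl}}(\mathcal{O}_{F_+})$ is the set of isomorphism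 classes of reflexive $\mathcal{O}_{F_+}$-modules of rank $1$. *)

theory Defs
  imports
    "Jordan_Normal_Form.VS_Connect"
    "HOL-Algebra.Ideal_Product"
    "HOL-Library.FuncSet"
    "HOL-Library.Multiset"
begin

section \<open>Modules over commutative semirings\<close>

locale csemiring = Ring.semiring R + Group.comm_monoid R for R (structure)

locale semimodule = R?: csemiring R + M?: abelian_monoid M
  for R :: "('a, 'x) ring_scheme" (structure) and M :: "('a, 'b, 'y) module_scheme" (structure) +
  assumes smult_closed:
      "\<lbrakk>a \<in> carrier R; x \<in> carrier M\<rbrakk> \<Longrightarrow> a \<odot>\<^bsub>M\<^esub> x \<in> carrier M"
    and smult_l_distr:
      "\<lbrakk>a \<in> carrier R; b \<in> carrier R; x \<in> carrier M\<rbrakk> \<Longrightarrow>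
        (a \<oplus>\<^bsub>R\<^esub> b) \<odot>\<^bsub>M\<^esub> x = a \<odot>\<^bsub>M\<^esub> x \<oplus>\<^bsub>M\<^esub> b \<odot>\<^bsub>M\<^esub> x"
    and smult_r_distr:
      "\<lbrakk>a \<in> carrier R; x \<in> carrier M; y \<in> carrier M\<rbrakk> \<Longrightarrow>
        a \<odot>\<^bsub>M\<^esub> (x \<oplus>\<^bsub>M\<^esub> y) = a \<odot>\<^bsub>M\<^esub> x \<oplus>\<^bsub>M\<^esub> a \<odot>\<^bsub>M\<^esub> y"
    and smult_l_null:
      "x \<in> carrier M \<Longrightarrow> \<zero>\<^bsub>R\<^esub> \<odot>\<^bsub>M\<^esub> x = \<zero>\<^bsub>M\<^esub>"
    and smult_r_null:
      "a \<in> carrier R \<Longrightarrow> a \<odot>\<^bsub>M\<^esub> \<zero>\<^bsub>M\<^esub> = \<zero>\<^bsub>M\<^esub>"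
    and smult_assoc:
      "\<lbrakk>a \<in> carrier R; b \<in> carrier R; x \<in> carrier M\<rbrakk> \<Longrightarrow>
        (a \<otimes>\<^bsub>R\<^esub> b) \<odot>\<^bsub>M\<^esub> x = a \<odot>\<^bsub>M\<^esub> (b \<odot>\<^bsub>M\<^esub> x)"
    and smult_one:
      "x \<in> carrier M \<Longrightarrow> \<one>\<^bsub>R\<^esub> \<odot>\<^bsub>M\<^esub> x = x"

text \<open>Linear maps are given by \<^const>\<open>LinearCombinations.module_hom\<close>. It does not ask for
  \<open>f 0 = 0\<close>, but this follows from homogeneity because \<open>0\<close> acts as zero.\<close>

lemma module_hom_zero:
  assumes "semimodule R M" "semimodule R N" "f \<in> LinearCombinations.module_hom R M N"
  shows "f \<zero>\<^bsub>M\<^esub> = \<zero>\<^bsub>N\<^esub>"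
proof -
  interpret M: semimodule R M by fact
  interpret N: semimodule R N by fact
  have "f \<zero>\<^bsub>M\<^esub> = f (\<zero>\<^bsub>R\<^esub> \<odot>\<^bsub>M\<^esub> \<zero>\<^bsub>M\<^esub>)"
    by (simp add: M.smult_l_null)
  also have "\<dots> = \<zero>\<^bsub>R\<^esub> \<odot>\<^bsub>N\<^esub> f \<zero>\<^bsub>M\<^esub>"
    using assms(3) by (simp add: LinearCombinations.module_hom_def)
  also have "\<dots> = \<zero>\<^bsub>N\<^esub>"
    using assms(3) by (intro N.smult_l_null) (auto simp: LinearCombinations.module_hom_def)
  finally show ?thesis .
qed

definition module_isos ::
  "('a, 'x) ring_scheme \<Rightarrow> ('a, 'b, 'y) module_scheme \<Rightarrow> ('a, 'c, 'z) module_scheme \<Rightarrow> ('b \<Rightarrow> 'c) set"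
  where "module_isos R M N =
    {f \<in> LinearCombinations.module_hom R M N. bij_betw f (carrier M) (carrier N)}"

definition regular_module :: "('a, 'x) ring_scheme \<Rightarrow> ('a, 'a) module"
  where "regular_module R =
    \<lparr>carrier = carrier R, mult = mult R, one = one R, zero = zero R, add = add R, smult = mult R\<rparr>"

subsection \<open>Duals and reflexivity\<close>

text \<open>Functionals are made \<^const>\<open>extensional\<close> so that each linear map on \<open>carrier M\<close> is
  represented by exactly one HOL function. The fields \<^const>\<open>mult\<close> and \<^const>\<open>one\<close>,
  which module records inherit from ring records, play no role.\<close>

definition dual :: "('a, 'x) ring_scheme \<Rightarrow> ('a, 'b, 'y) module_scheme \<Rightarrow> ('a, 'b \<Rightarrow> 'a) module"
  where "dual R M =
    \<lparr>carrier = LinearCombinations.module_hom R M (regular_module R) \<inter> extensional (carrier M),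
     mult = undefined, one = undefined,
     zero = (\<lambda>x\<in>carrier M. \<zero>\<^bsub>R\<^esub>),
     add = (\<lambda>\<phi> \<chi>. \<lambda>x\<in>carrier M. \<phi> x \<oplus>\<^bsub>R\<^esub> \<chi> x),
     smult = (\<lambda>a \<chi>. \<lambda>x\<in>carrier M. a \<otimes>\<^bsub>R\<^esub> \<chi> x)\<rparr>"

definition reflexive :: "('a, 'x) ring_scheme \<Rightarrow> ('a, 'b, 'y) module_scheme \<Rightarrow> bool"
  where "reflexive R M \<longleftrightarrow>
    (\<lambda>x. \<lambda>\<chi>\<in>carrier (dual R M). \<chi> x) \<in> module_isos R M (dual R (dual R M))"

subsection \<open>Tensor products\<close>

text \<open>A finite multiset \<open>{#(m\<^sub>1, n\<^sub>1), \<dots>, (m\<^sub>k, n\<^sub>k)#}\<close> stands for the sum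
  \<open>m\<^sub>1 \<otimes> n\<^sub>1 + \<dots> + m\<^sub>k \<otimes> n\<^sub>k\<close>. The tensor product is the quotient of the free
  commutative monoid on \<open>carrier M \<times> carrier N\<close> by the congruence generated by the bilinearity
  relations.\<close>

inductive tensor_eq ::
  "('a, 'x) ring_scheme \<Rightarrow> ('a, 'b, 'y) module_scheme \<Rightarrow> ('a, 'c, 'z) module_scheme \<Rightarrow>
    ('b \<times> 'c) multiset \<Rightarrow> ('b \<times> 'c) multiset \<Rightarrow> bool"
  for R and M and N
  where
    refl: "set_mset X \<subseteq> carrier M \<times> carrier N \<Longrightarrow> tensor_eq R M N X X"
  | sym: "tensor_eq R M N X Y \<Longrightarrow> tensor_eq R M N Y X"
  | trans: "tensor_eq R M N X Y \<Longrightarrow> tensor_eq R M N Y Z \<Longrightarrow> tensor_eq R M N X Z"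
  | plus: "tensor_eq R M N X Y \<Longrightarrow> tensor_eq R M N X' Y' \<Longrightarrow> tensor_eq R M N (X + X') (Y + Y')"
  | add_left: "\<lbrakk>m \<in> carrier M; m' \<in> carrier M; n \<in> carrier N\<rbrakk> \<Longrightarrow>
      tensor_eq R M N {#(m \<oplus>\<^bsub>M\<^esub> m', n)#} {#(m, n), (m', n)#}"
  | add_right: "\<lbrakk>m \<in> carrier M; n \<in> carrier N; n' \<in> carrier N\<rbrakk> \<Longrightarrow>
      tensor_eq R M N {#(m, n \<oplus>\<^bsub>N\<^esub> n')#} {#(m, n), (m, n')#}"
  | zero_left: "n \<in> carrier N \<Longrightarrow> tensor_eq R M N {#(\<zero>\<^bsub>M\<^esub>, n)#} {#}"
  | zero_right: "m \<in> carrier M \<Longrightarrow> tensor_eq R M N {#(m, \<zero>\<^bsub>N\<^esub>)#} {#}"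
  | balanced: "\<lbrakk>a \<in> carrier R; m \<in> carrier M; n \<in> carrier N\<rbrakk> \<Longrightarrow>
      tensor_eq R M N {#(a \<odot>\<^bsub>M\<^esub> m, n)#} {#(m, a \<odot>\<^bsub>N\<^esub> n)#}"

abbreviation tensor_class ::
  "('a, 'x) ring_scheme \<Rightarrow> ('a, 'b, 'y) module_scheme \<Rightarrow> ('a, 'c, 'z) module_scheme \<Rightarrow>
    ('b \<times> 'c) multiset \<Rightarrow> ('b \<times> 'c) multiset set"
  where "tensor_class R M N X \<equiv> {Y. tensor_eq R M N X Y}"

text \<open>Scalars act through the first factor. If \<open>M\<close> is moreover a module over a semiring
  \<open>B\<close> extending \<open>R\<close>, with \<open>smult M\<close> giving that action, then the same formula is the action of
  \<open>B\<close> on \<open>M \<otimes>\<^sub>R N\<close>; in particular \<open>tensor R (regular_module B) N\<close> is the base change of \<open>N\<close>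
  to \<open>B\<close>.\<close>

definition tensor ::
  "('a, 'x) ring_scheme \<Rightarrow> ('a, 'b, 'y) module_scheme \<Rightarrow> ('a, 'c, 'z) module_scheme \<Rightarrow>
    ('a, ('b \<times> 'c) multiset set) module"
  where "tensor R M N =
    \<lparr>carrier = tensor_class R M N ` {X. set_mset X \<subseteq> carrier M \<times> carrier N},
     mult = undefined, one = undefined,
     zero = tensor_class R M N {#},
     add = (\<lambda>C D. \<Union>X\<in>C. \<Union>Y\<in>D. tensor_class R M N (X + Y)),
     smult = (\<lambda>a C. \<Union>X\<in>C. tensor_class R M N (image_mset (\<lambda>(m, n). (a \<odot>\<^bsub>M\<^esub> m, n)) X))\<rparr>"

subsection \<open>Isomorphism classes of reflexive modules of rank 1\<close>

text \<open>Here the semiring \<open>A\<close> has its carrier inside a field type \<open>'f\<close> and carries the operations of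
  that field; \<^term>\<open>class_ring :: 'f::field ring\<close> is the whole field. The condition
  \<^const>\<open>vectorspace.fin_dim\<close> is needed because \<^const>\<open>vectorspace.dim\<close> is a \<open>LEAST\<close> over
  finite generating sets.\<close>

definition rank_one :: "('f::field) ring \<Rightarrow> ('f, 'm) module \<Rightarrow> bool"
  where "rank_one A L \<longleftrightarrow>
    (let F = (class_ring :: 'f ring); V = tensor A (regular_module F) L
     in vectorspace F V \<and> vectorspace.fin_dim F V \<and> vectorspace.dim F V = 1)"

text \<open>The modules in a class have their carriers in the type \<open>'m\<close>, which serves as the universe;
  the given module \<open>N\<close> may live on a different type.\<close>

definition iso_class :: "'a ring \<Rightarrow> ('a, 'n) module \<Rightarrow> ('a, 'm) module set"
  where "iso_class A N = {L. semimodule A L \<and> module_isos A L N \<noteq> {}}"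

definition Pic_refl :: "('f::field) ring \<Rightarrow> ('f, 'm) module set set"
  where "Pic_refl A =
    {iso_class A L | L :: ('f, 'm) module. semimodule A L \<and> reflexive A L \<and> rank_one A L}"


section \<open>Number fields\<close>

definition number_field :: "'f::field_char_0 itself \<Rightarrow> bool"
  where "number_field _ \<longleftrightarrow>
    (\<exists>B. finite_dimensional_vector_space (\<lambda>(q :: rat) (x :: 'f). of_rat q * x) B)"

definition integers_of :: "('f::field_char_0) set"
  where "integers_of = {x. algebraic_int x}"

definition nonneg_part :: "('f::field_char_0 \<Rightarrow> real) set \<Rightarrow> 'f set \<Rightarrow> 'f set"
  where "nonneg_part S I = {x \<in> I. \<forall>\<sigma>\<in>S. \<sigma> x \<ge> 0}"

definition nonneg_integers :: "('f::field_char_0 \<Rightarrow> real) set \<Rightarrow> 'f ring"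
  where "nonneg_integers S = class_ring\<lparr>carrier := nonneg_part S integers_of\<rparr>"

definition nonneg_module :: "('f::field_char_0 \<Rightarrow> real) set \<Rightarrow> 'f set \<Rightarrow> ('f, 'f) module"
  where "nonneg_module S I = (regular_module class_ring)\<lparr>carrier := nonneg_part S I\<rparr>"

text \<open>Closure under negation follows from \<open>- 1 \<in> integers_of\<close>.\<close>

definition fractional_ideal :: "('f::field_char_0) set \<Rightarrow> bool"
  where "fractional_ideal I \<longleftrightarrow>
    0 \<in> I \<and> (\<forall>x\<in>I. \<forall>y\<in>I. x + y \<in> I) \<and> (\<forall>a\<in>integers_of. \<forall>x\<in>I. a * x \<in> I) \<and>
    I \<noteq> {0} \<and> (\<exists>d\<in>integers_of. d \<noteq> 0 \<and> (\<forall>x\<in>I. d * x \<in> integers_of))"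

definition ideal_group :: "('f::field_char_0) set monoid"
  where "ideal_group =
    \<lparr>carrier = {I. fractional_ideal I}, mult = ideal_prod class_ring, one = integers_of\<rparr>"

definition principal_ideals :: "('f::field_char_0 \<Rightarrow> real) set \<Rightarrow> 'f set set"
  where "principal_ideals S = {(\<lambda>x. \<beta> * x) ` integers_of | \<beta>. \<beta> \<noteq> 0 \<and> (\<forall>\<sigma>\<in>S. \<sigma> \<beta> \<ge> 0)}"

definition class_group :: "('f::field_char_0 \<Rightarrow> real) set \<Rightarrow> 'f set set monoid"
  where "class_group S = ideal_group Mod principal_ideals S"

definition ideal_class :: "('f::field_char_0 \<Rightarrow> real) set \<Rightarrow> 'f set \<Rightarrow> 'f set set"
  where "ideal_class S I = principal_ideals S #>\<^bsub>ideal_group\<^esub> I"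

end

theory Submission
  imports Defs "Jordan_Normal_Form.Char_Poly" "HOL-Library.Countable_Set"
begin

text \<open>
  Write \<open>A\<close> for the semiring of \<open>S\<close>-nonnegative integers. Squares are nonnegative at every real place,
  so \<open>2 y + (y\<^sup>2 + 1) = (y + 1)\<^sup>2\<close> shows that every element of \<open>F\<close> is \<open>(u - v) / n\<close> with
  \<open>u, v, n\<close> in \<open>A\<close>. Two things follow for an \<open>A\<close>-submodule \<open>M\<close> of \<open>F\<close>, \<open>M \<noteq> 0\<close>: an \<open>A\<close>-linear map
  from \<open>M\<close> to \<open>F\<close> is multiplication by an element of \<open>F\<close> (\<open>functional_is_multiplication\<close>), so that
  the dual of \<open>M\<close> is \<open>M' = {y. y M \<subseteq> A}\<close>; and \<open>F \<otimes>\<^sub>A M\<close> is one-dimensional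
  (\<open>rank_one_if_embedded\<close>). Conversely the functionals of a reflexive module of rank 1 separate its
  points and are all proportional, so each nonzero functional embeds it into \<open>A\<close>
  (\<open>reflexive_rank_one_embeds\<close>). The theorem is therefore about those \<open>M\<close> with \<open>M'' = M\<close>.

  If \<open>M = I\<^sub>+\<close> for a fractional ideal \<open>I\<close>, then \<open>M' = (I\<^sup>-\<^sup>1)\<^sub>+\<close> (\<open>positive_dual\<close>), because \<open>I\<^sub>+\<close> contains
  a positive integer and generates \<open>I\<close> as a group. Hence \<open>M'' = M\<close>, since \<open>(I\<^sup>-\<^sup>1)\<^sup>-\<^sup>1 = I\<close>. If, on the other
  hand, \<open>M \<subseteq> A\<close> and \<open>M'' = M\<close>, then \<open>M\<close> consists of the \<open>z\<close> with \<open>z M' \<subseteq> A\<close>. Integrality of the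
  products \<open>z y\<close>, \<open>y \<in> M'\<close>, defines a fractional ideal \<open>I\<close>. As \<open>M\<close> contains a nonzero element,
  which is positive at every place of \<open>S\<close>, the elements of \<open>M'\<close> are nonnegative there, and the sign
  conditions on \<open>z y\<close> hold as soon as \<open>\<sigma> z \<ge> 0\<close> for all \<open>\<sigma> \<in> S\<close>. Thus \<open>M = I\<^sub>+\<close>. Finally an
  isomorphism from \<open>I\<^sub>+\<close> to \<open>J\<^sub>+\<close> is multiplication by some \<open>\<beta>\<close>; then \<open>J = \<beta> I\<close>, and \<open>\<sigma> \<beta> \<ge> 0\<close>
  because \<open>\<beta>\<close> times a positive integer lies in \<open>J\<^sub>+\<close>. So isomorphism of the modules is equality of
  the ideal classes.

  The arithmetic input is \<open>(I\<^sup>-\<^sup>1)\<^sup>-\<^sup>1 = I\<close>. It is obtained without prime ideals from three facts about the ring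
  \<open>O\<close> of integers: \<open>O / N O\<close> is finite (\<open>finite_residues\<close>), \<open>O\<close> is completely integrally closed
  (\<open>integers_completely_integrally_closed\<close>), and a proper ideal of the finite ring \<open>O / N O\<close> has a
  nonzero annihilator (\<open>proper_ideal_annihilated_modulo\<close>).
\<close>

section \<open>Sums and products of algebraic integers\<close>

text \<open>The determinant trick: \<open>x\<close> is an eigenvalue of the integer matrix \<open>a\<close>, hence a root of its
  characteristic polynomial, which is monic with integer coefficients.\<close>

lemma algebraic_int_if_integral_action:
  fixes v :: "'i \<Rightarrow> 'a::field_char_0" and a :: "'i \<Rightarrow> 'i \<Rightarrow> int"
  assumes "finite I" and act: "\<And>i. i \<in> I \<Longrightarrow> x * v i = (\<Sum>j\<in>I. of_int (a i j) * v j)"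
    and i0: "i0 \<in> I" "v i0 \<noteq> 0"
  shows "algebraic_int x"
proof -
  define n where "n = card I"
  obtain h where h: "bij_betw h {0..<n} I"
    using ex_bij_betw_nat_finite[OF \<open>finite I\<close>] n_def by blast
  define A where "A = mat n n (\<lambda>(i, j). a (h i) (h j))"
  define w where "w = vec n (\<lambda>i. v (h i))"
  let ?A = "map_mat of_int A :: 'a mat"
  have A: "A \<in> carrier_mat n n" and A': "?A \<in> carrier_mat n n"
    by (auto simp: A_def)
  have hI: "h i \<in> I" if "i < n" for i
    using h that by (auto simp: bij_betw_def)
  have "?A *\<^sub>v w = x \<cdot>\<^sub>v w"
  proof (rule eq_vecI)
    fix i assume "i < dim_vec (x \<cdot>\<^sub>v w)"
    hence i: "i < n" by (simp add: w_def)
    have "(?A *\<^sub>v w) $ i = (\<Sum>j\<in>{0..<n}. of_int (a (h i) (h j)) * v (h j))"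
      using i by (simp add: A_def w_def scalar_prod_def)
    also have "\<dots> = (\<Sum>j\<in>I. of_int (a (h i) j) * v j)"
      by (rule sum.reindex_bij_betw[OF h])
    also have "\<dots> = (x \<cdot>\<^sub>v w) $ i"
      using i act[OF hI[OF i]] by (simp add: w_def)
    finally show "(?A *\<^sub>v w) $ i = (x \<cdot>\<^sub>v w) $ i" .
  qed (simp add: A_def w_def)
  moreover have "w \<noteq> 0\<^sub>v n"
  proof -
    obtain k where "k < n" "h k = i0"
      using h i0(1) by (auto simp: bij_betw_def image_iff)
    hence "w $ k \<noteq> 0\<^sub>v n $ k" using i0(2) by (simp add: w_def)
    thus ?thesis by auto
  qed
  ultimately have "eigenvalue ?A x"
    using A by (auto simp: eigenvalue_def eigenvector_def w_def intro!: exI[of _ w])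
  hence "poly (char_poly ?A) x = 0"
    using eigenvalue_root_char_poly[OF A'] by simp
  hence "poly (map_poly of_int (char_poly A)) x = 0"
    by (simp add: of_int_hom.char_poly_hom[OF A])
  moreover have "lead_coeff (char_poly A) = 1"
    using degree_monic_char_poly[OF A] by auto
  ultimately show ?thesis
    unfolding algebraic_int_altdef_ipoly by blast
qed

text \<open>Multiplication by \<open>x\<close> acts on the family \<open>v\<close> through an integer matrix. For a fixed family the
  elements with this property form a ring, so sums and products of algebraic integers are handled
  by giving both of them an action on one common family, the products of their powers.\<close>

definition integral_action :: "'i set \<Rightarrow> ('i \<Rightarrow> 'a::field_char_0) \<Rightarrow> 'a \<Rightarrow> bool" where
  "integral_action I v x \<longleftrightarrow> (\<exists>a :: 'i \<Rightarrow> 'i \<Rightarrow> int. \<forall>i\<in>I. x * v i = (\<Sum>j\<in>I. of_int (a i j) * v j))"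

lemma integral_action_add:
  assumes "integral_action I v x" "integral_action I v y"
  shows "integral_action I v (x + y)"
proof -
  obtain a b where a: "\<forall>i\<in>I. x * v i = (\<Sum>j\<in>I. of_int (a i j) * v j)"
    and b: "\<forall>i\<in>I. y * v i = (\<Sum>j\<in>I. of_int (b i j) * v j)"
    using assms unfolding integral_action_def by blast
  have "(x + y) * v i = (\<Sum>j\<in>I. of_int (a i j + b i j) * v j)" if "i \<in> I" for i
    using a b that by (simp add: ring_distribs sum.distrib)
  thus ?thesis unfolding integral_action_def
    by (intro exI[of _ "\<lambda>i j. a i j + b i j"]) blast
qed

lemma integral_action_mult:
  assumes "integral_action I v x" "integral_action I v y"
  shows "integral_action I v (x * y)"
proof -
  obtain a b where a: "\<forall>i\<in>I. x * v i = (\<Sum>j\<in>I. of_int (a i j) * v j)"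
    and b: "\<forall>i\<in>I. y * v i = (\<Sum>j\<in>I. of_int (b i j) * v j)"
    using assms unfolding integral_action_def by blast
  have "(x * y) * v i = (\<Sum>j\<in>I. of_int (\<Sum>k\<in>I. b i k * a k j) * v j)" if "i \<in> I" for i
  proof -
    have "(x * y) * v i = (\<Sum>k\<in>I. of_int (b i k) * (x * v k))"
      using b that by (simp add: mult.assoc sum_distrib_left algebra_simps)
    also have "\<dots> = (\<Sum>k\<in>I. \<Sum>j\<in>I. of_int (b i k * a k j) * v j)"
      using a by (intro sum.cong) (simp_all add: sum_distrib_left mult.assoc)
    also have "\<dots> = (\<Sum>j\<in>I. \<Sum>k\<in>I. of_int (b i k * a k j) * v j)"
      by (rule sum.swap)
    finally show ?thesis by (simp add: sum_distrib_right)
  qed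
  thus ?thesis unfolding integral_action_def
    by (intro exI[of _ "\<lambda>i j. \<Sum>k\<in>I. b i k * a k j"]) blast
qed

text \<open>The matrix is the companion matrix of the monic integer polynomial that vanishes at \<open>x\<close>.\<close>

lemma algebraic_int_powers_stable:
  fixes x :: "'a::field_char_0"
  assumes "algebraic_int x"
  obtains n where "n > 0" "integral_action {..<n} (\<lambda>i. x ^ i) x"
proof -
  obtain p where p: "poly (map_poly of_int p) x = 0" "lead_coeff p = 1"
    using assms unfolding algebraic_int_altdef_ipoly by blast
  define n where "n = degree p"
  have pq: "poly (map_poly of_int p) x = (\<Sum>i\<le>n. of_int (coeff p i) * x ^ i)"
    by (simp add: poly_altdef n_def of_int_hom.degree_map_poly_hom of_int_hom.coeff_map_poly_hom)
  have "n > 0"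
  proof (rule ccontr)
    assume "\<not> n > 0"
    thus False using p pq by (simp add: n_def)
  qed
  have top: "x ^ n = (\<Sum>j<n. of_int (- coeff p j) * x ^ j)"
  proof -
    have "(\<Sum>i<n. of_int (coeff p i) * x ^ i) + x ^ n = 0"
      using p pq by (simp add: lessThan_Suc_atMost[symmetric] n_def)
    thus ?thesis by (simp add: sum_negf eq_neg_iff_add_eq_0 add.commute)
  qed
  define a where "a = (\<lambda>i j. if Suc i < n then (if j = Suc i then 1 else 0) else - coeff p j)"
  have "x * x ^ i = (\<Sum>j<n. of_int (a i j) * x ^ j)" if "i < n" for i
  proof (cases "Suc i < n")
    case True
    have "(\<Sum>j<n. of_int (a i j) * x ^ j) = (\<Sum>j<n. if j = Suc i then x ^ j else 0)"
      using True by (intro sum.cong) (auto simp: a_def)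
    thus ?thesis using True by simp
  next
    case False
    hence "n = Suc i" using that by simp
    thus ?thesis using top by (simp add: a_def)
  qed
  hence "integral_action {..<n} (\<lambda>i. x ^ i) x"
    unfolding integral_action_def by blast
  thus ?thesis using that \<open>n > 0\<close> by blast
qed

lemma integral_action_times_left:
  assumes "finite J" "integral_action I v x"
  shows "integral_action (I \<times> J) (\<lambda>(i, j). v i * w j) x"
proof -
  obtain a where a: "\<forall>i\<in>I. x * v i = (\<Sum>j\<in>I. of_int (a i j) * v j)"
    using assms unfolding integral_action_def by blast
  have "x * (v i * w j) = (\<Sum>(k, l)\<in>I \<times> J. of_int (if l = j then a i k else 0) * (v k * w l))"
    if "i \<in> I" "j \<in> J" for i j
  proof -
    have "(\<Sum>(k, l)\<in>I \<times> J. of_int (if l = j then a i k else 0) * (v k * w l)) =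
        (\<Sum>k\<in>I. \<Sum>l\<in>J. if l = j then of_int (a i k) * (v k * w l) else 0)"
      unfolding sum.cartesian_product by (intro sum.cong) auto
    also have "\<dots> = (\<Sum>k\<in>I. of_int (a i k) * v k) * w j"
      using that \<open>finite J\<close> by (simp add: sum_distrib_right mult.assoc)
    finally show ?thesis using a that by (simp add: mult.assoc)
  qed
  thus ?thesis unfolding integral_action_def
    by (intro exI[of _ "\<lambda>(i, j) (k, l). if l = j then a i k else 0"])
       (auto simp: case_prod_unfold cong: if_cong)
qed

lemma integral_action_times_right:
  assumes "finite I" "integral_action J w y"
  shows "integral_action (I \<times> J) (\<lambda>(i, j). v i * w j) y"
proof -
  obtain a where a: "\<forall>i\<in>J. y * w i = (\<Sum>j\<in>J. of_int (a i j) * w j)"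
    using assms unfolding integral_action_def by blast
  have "y * (v i * w j) = (\<Sum>(k, l)\<in>I \<times> J. of_int (if k = i then a j l else 0) * (v k * w l))"
    if "i \<in> I" "j \<in> J" for i j
  proof -
    have "(\<Sum>(k, l)\<in>I \<times> J. of_int (if k = i then a j l else 0) * (v k * w l)) =
        (\<Sum>k\<in>I. if k = i then (\<Sum>l\<in>J. of_int (a j l) * (v k * w l)) else 0)"
      unfolding sum.cartesian_product[symmetric] by (intro sum.cong) auto
    also have "\<dots> = v i * (\<Sum>l\<in>J. of_int (a j l) * w l)"
      using that \<open>finite I\<close> by (simp add: sum_distrib_left mult_ac)
    finally show ?thesis using a that by (simp add: algebra_simps)
  qed
  thus ?thesis unfolding integral_action_def
    by (intro exI[of _ "\<lambda>(i, j) (k, l). if k = i then a j l else 0"])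
       (auto simp: case_prod_unfold cong: if_cong)
qed

lemma algebraic_int_add_mult:
  fixes x y :: "'a::field_char_0"
  assumes "algebraic_int x" "algebraic_int y"
  shows algebraic_int_add: "algebraic_int (x + y)"
    and algebraic_int_mult: "algebraic_int (x * y)"
proof -
  obtain n m where "n > 0" "m > 0"
    and n: "integral_action {..<n} (\<lambda>i. x ^ i) x" and m: "integral_action {..<m} (\<lambda>i. y ^ i) y"
    using algebraic_int_powers_stable[OF assms(1)] algebraic_int_powers_stable[OF assms(2)] by metis
  let ?I = "{..<n} \<times> {..<m}" and ?v = "\<lambda>(i, j). x ^ i * y ^ j"
  have x: "integral_action ?I ?v x" and y: "integral_action ?I ?v y"
    using integral_action_times_left[OF _ n] integral_action_times_right[OF _ m] by auto
  have "algebraic_int z" if "integral_action ?I ?v z" for z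
  proof -
    from that[unfolded integral_action_def]
    obtain a where "\<forall>i\<in>?I. z * ?v i = (\<Sum>j\<in>?I. of_int (a i j) * ?v j)" ..
    thus ?thesis
      using \<open>n > 0\<close> \<open>m > 0\<close>
      by (intro algebraic_int_if_integral_action[where I = ?I and v = ?v and a = a and ?i0.0 = "(0, 0)"])
         auto
  qed
  thus "algebraic_int (x + y)" "algebraic_int (x * y)"
    using integral_action_add[OF x y] integral_action_mult[OF x y] by blast+
qed

lemma integers_of_closed:
  fixes x y :: "'f::field_char_0"
  shows integers_of_0: "(0::'f) \<in> integers_of" and integers_of_1: "(1::'f) \<in> integers_of"
    and integers_of_of_int: "(of_int k :: 'f) \<in> integers_of"
    and integers_of_of_nat: "(of_nat n :: 'f) \<in> integers_of"
    and integers_of_add: "x \<in> integers_of \<Longrightarrow> y \<in> integers_of \<Longrightarrow> x + y \<in> integers_of"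
    and integers_of_mult: "x \<in> integers_of \<Longrightarrow> y \<in> integers_of \<Longrightarrow> x * y \<in> integers_of"
    and integers_of_minus: "x \<in> integers_of \<Longrightarrow> - x \<in> integers_of"
    and integers_of_diff: "x \<in> integers_of \<Longrightarrow> y \<in> integers_of \<Longrightarrow> x - y \<in> integers_of"
    and integers_of_power: "x \<in> integers_of \<Longrightarrow> x ^ n \<in> integers_of"
proof -
  show m: "x * y \<in> integers_of" if "x \<in> integers_of" "y \<in> integers_of" for x y :: 'f
    using that by (simp add: integers_of_def algebraic_int_mult)
  show "x - y \<in> integers_of" if "x \<in> integers_of" "y \<in> integers_of"
    using that algebraic_int_add[of x "- y"] by (simp add: integers_of_def)
  show "x ^ n \<in> integers_of" if "x \<in> integers_of"
    using that m by (induction n) (simp_all add: integers_of_def)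
qed (simp_all add: integers_of_def algebraic_int_add)

lemma integers_of_sum:
  "(\<And>i. i \<in> I \<Longrightarrow> f i \<in> integers_of) \<Longrightarrow> (\<Sum>i\<in>I. f i) \<in> integers_of"
  by (induction I rule: infinite_finite_induct) (auto intro: integers_of_closed)

section \<open>Generators and denominators in a number field\<close>

lemma number_field_dependent:
  assumes "number_field TYPE('f::field_char_0)"
  obtains d where "\<And>C :: 'f set. finite C \<Longrightarrow> card C > d \<Longrightarrow>
    \<exists>u :: 'f \<Rightarrow> rat. (\<Sum>b\<in>C. of_rat (u b) * b) = 0 \<and> (\<exists>b\<in>C. u b \<noteq> 0)"
proof -
  obtain B where "finite_dimensional_vector_space (\<lambda>(q :: rat) (x :: 'f). of_rat q * x) B"
    using assms unfolding number_field_def by blast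
  then interpret fd: finite_dimensional_vector_space "\<lambda>(q :: rat) (x :: 'f). of_rat q * x" B .
  show ?thesis
  proof (rule that[of "card B"])
    fix C :: "'f set" assume C: "finite C" "card C > card B"
    have "\<not> fd.independent C"
      using fd.independent_card_le_dim[of C UNIV] C by (auto simp: fd.dim_UNIV fd.dimension_def)
    then show "\<exists>u :: 'f \<Rightarrow> rat. (\<Sum>b\<in>C. of_rat (u b) * b) = 0 \<and> (\<exists>b\<in>C. u b \<noteq> 0)"
      using fd.dependent_finite[OF C(1)] by blast
  qed
qed

lemma common_denominator:
  fixes u :: "'b \<Rightarrow> rat"
  assumes "finite C"
  shows "\<exists>D::nat. D > 0 \<and> (\<forall>b\<in>C. \<exists>k::int. of_nat D * u b = of_int k)"
  using assms
proof (induction C)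
  case (insert b C)
  then obtain D :: nat where D: "D > 0" "\<forall>b\<in>C. \<exists>k::int. of_nat D * u b = of_int k" by blast
  obtain n m where nm: "m > 0" "u b = of_int n / of_int m"
    by (metis quotient_of_denom_pos quotient_of_div surj_pair)
  define E where "E = nat m"
  have E: "E > 0" "of_nat E * u b = of_int n"
    using nm by (auto simp: E_def)
  have "\<exists>k::int. of_nat (E * D) * u x = of_int k" if "x \<in> insert b C" for x
  proof (cases "x = b")
    case True
    have "of_nat (E * D) * u b = of_int (int D * n)"
      using E(2) by (simp add: mult_ac)
    thus ?thesis using True by blast
  next
    case False
    hence "x \<in> C" using that by simp
    with D(2) obtain k where "of_nat D * u x = of_int k" by (elim ballE exE) auto
    hence "of_nat (E * D) * u x = of_int (int E * k)" by (simp add: mult_ac)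
    thus ?thesis by blast
  qed
  thus ?case using D E by (intro exI[of _ "E * D"]) auto
qed (auto intro: exI[of _ 1])

lemma number_field_spanning:
  assumes "number_field TYPE('f::field_char_0)"
  obtains B :: "'f::field_char_0 set" where "finite B" "\<And>y. \<exists>u. y = (\<Sum>b\<in>B. of_rat (u b) * b)" "\<exists>b\<in>B. b \<noteq> 0"
proof -
  obtain B where "finite_dimensional_vector_space (\<lambda>(q :: rat) (x :: 'f). of_rat q * x) B"
    using assms unfolding number_field_def by blast
  then interpret fd: finite_dimensional_vector_space "\<lambda>(q :: rat) (x :: 'f). of_rat q * x" B .
  have span: "\<exists>u. y = (\<Sum>b\<in>B. of_rat (u b) * b)" for y
    using fd.span_finite[OF fd.finite_Basis] fd.span_Basis by blast
  moreover have "\<exists>b\<in>B. b \<noteq> 0"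
  proof (rule ccontr)
    assume *: "\<not> (\<exists>b\<in>B. b \<noteq> 0)"
    obtain u where "1 = (\<Sum>b\<in>B. of_rat (u b) * b)" using span[of 1] by blast
    also have "\<dots> = 0" using * by (intro sum.neutral) auto
    finally show False by simp
  qed
  ultimately show ?thesis using that fd.finite_Basis by blast
qed

text \<open>With respect to a \<open>\<rat>\<close>-basis of the field, multiplication by \<open>x\<close> is a rational matrix. If \<open>D\<close> is a
  common denominator of its entries, then \<open>D x\<close> acts on the basis by an integer matrix.\<close>

lemma number_field_denominator:
  fixes x :: "'f::field_char_0"
  assumes "number_field TYPE('f)"
  obtains D :: nat where "D > 0" "of_nat D * x \<in> integers_of"
proof -
  obtain B :: "'f set" where B: "finite B" "\<And>y. \<exists>u. y = (\<Sum>b\<in>B. of_rat (u b) * b)" "\<exists>b\<in>B. b \<noteq> 0"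
    using number_field_spanning[OF assms] by metis
  have "\<exists>q. \<forall>b. x * b = (\<Sum>c\<in>B. of_rat (q b c) * c)"
    using B(2) by (intro choice allI)
  then obtain q where q: "\<And>b. x * b = (\<Sum>c\<in>B. of_rat (q b c) * c)" by blast
  obtain D :: nat where D: "D > 0" "\<forall>p\<in>B \<times> B. \<exists>k::int. of_nat D * q (fst p) (snd p) = of_int k"
    using common_denominator[of "B \<times> B" "\<lambda>p. q (fst p) (snd p)"] B(1) by auto
  have "\<forall>b\<in>B. \<forall>c\<in>B. \<exists>k::int. of_nat D * q b c = of_int k" using D(2) by auto
  then obtain a :: "'f \<Rightarrow> 'f \<Rightarrow> int" where a: "\<And>b c. b \<in> B \<Longrightarrow> c \<in> B \<Longrightarrow> of_nat D * q b c = of_int (a b c)"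
    by metis
  obtain b0 where b0: "b0 \<in> B" "b0 \<noteq> 0" using B(3) by blast
  have "algebraic_int (of_nat D * x)"
  proof (rule algebraic_int_if_integral_action[where v = "\<lambda>b. b" and a = a, OF B(1) _ b0])
    fix b assume b: "b \<in> B"
    have "of_nat D * x * b = (\<Sum>c\<in>B. of_nat D * (of_rat (q b c) * c))"
      by (simp add: mult.assoc q sum_distrib_left)
    also have "\<dots> = (\<Sum>c\<in>B. of_int (a b c) * c)"
    proof (rule sum.cong)
      fix c assume "c \<in> B"
      have "(of_int (a b c) :: 'f) = of_rat (of_nat D * q b c)" using a[OF b \<open>c \<in> B\<close>] by simp
      thus "of_nat D * (of_rat (q b c) * c) = of_int (a b c) * c"
        by (simp add: of_rat_mult mult.assoc)
    qed simp
    finally show "of_nat D * x * b = (\<Sum>c\<in>B. of_int (a b c) * c)" .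
  qed
  thus ?thesis using that D(1) by (simp add: integers_of_def)
qed

lemma countable_rational_span:
  fixes B :: "'f::field_char_0 set"
  assumes "finite B"
  shows "countable (range (\<lambda>u. \<Sum>b\<in>B. of_rat (u b) * b))"
  using assms
proof (induction B)
  case (insert b B)
  let ?R = "range (\<lambda>u. \<Sum>b\<in>B. of_rat (u b) * b)"
  have "range (\<lambda>u. \<Sum>b\<in>insert b B. of_rat (u b) * b) \<subseteq>
      (\<lambda>(q, s). of_rat q * b + s) ` (UNIV \<times> ?R)"
  proof clarify
    fix u :: "'f \<Rightarrow> rat"
    show "(\<Sum>b\<in>insert b B. of_rat (u b) * b) \<in> (\<lambda>(q, s). of_rat q * b + s) ` (UNIV \<times> ?R)"
      using insert.hyps by (intro image_eqI[of _ _ "(u b, \<Sum>b\<in>B. of_rat (u b) * b)"]) auto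
  qed
  moreover have "countable ((UNIV :: rat set) \<times> ?R)"
    using insert.IH by (intro countable_SIGMA) auto
  ultimately show ?case by (meson countable_image countable_subset)
qed simp

lemma number_field_countable:
  assumes "number_field TYPE('f::field_char_0)"
  shows "countable (UNIV :: 'f set)"
proof -
  obtain B :: "'f set" where B: "finite B" "\<And>y. \<exists>u. y = (\<Sum>b\<in>B. of_rat (u b) * b)"
    using number_field_spanning[OF assms] by metis
  hence "UNIV \<subseteq> range (\<lambda>u. \<Sum>b\<in>B. of_rat (u b) * b)" by blast
  thus ?thesis using countable_rational_span[OF B(1)] countable_subset by blast
qed

lemma number_field_embeds_in_infinite:
  assumes "number_field TYPE('f::field_char_0)" "infinite (UNIV :: 'm set)"
  obtains g :: "'f::field_char_0 \<Rightarrow> 'm" where "inj g"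
proof -
  obtain h :: "nat \<Rightarrow> 'm" where "inj h"
    using assms(2) infinite_countable_subset by blast
  hence "inj (h \<circ> to_nat_on (UNIV :: 'f set))"
    using inj_on_to_nat_on[OF number_field_countable[OF assms(1)]] by (intro inj_compose)
  thus ?thesis using that by blast
qed

section \<open>Finiteness of residue rings\<close>

text \<open>For prime \<open>p\<close> this is linear independence, over the field with \<open>p\<close> elements, of the images of \<open>C\<close> in
  the ring of integers modulo \<open>p\<close>.\<close>

definition independent_modulo :: "nat \<Rightarrow> 'f::field_char_0 set \<Rightarrow> bool" where
  "independent_modulo p C \<longleftrightarrow> finite C \<and> C \<subseteq> integers_of \<and>
    (\<forall>c :: 'f \<Rightarrow> int. (\<Sum>b\<in>C. of_int (c b) * b) \<in> (\<lambda>y. of_nat p * y) ` integers_of \<longrightarrow>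
      (\<forall>b\<in>C. int p dvd c b))"

text \<open>Infinite descent: all coefficients of an integer relation are divisible by \<open>p\<close>, and dividing
  by \<open>p\<close> gives a smaller relation.\<close>

lemma independent_modulo_relation_trivial:
  fixes c :: "'f::field_char_0 \<Rightarrow> int"
  assumes "independent_modulo p C" "p > 1" "(\<Sum>b\<in>C. of_int (c b) * b) = 0" "b \<in> C"
  shows "c b = 0"
  using assms(3,4)
proof (induction "nat (\<Sum>b\<in>C. \<bar>c b\<bar>)" arbitrary: c b rule: less_induct)
  case less
  have fin: "finite C" using assms(1) by (simp add: independent_modulo_def)
  have "(0::'f) \<in> (\<lambda>y. of_nat p * y) ` integers_of"
    by (rule image_eqI[of _ _ 0]) (simp_all add: integers_of_0)
  hence dvd: "\<forall>b\<in>C. int p dvd c b"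
    using assms(1) less.prems(1) by (auto simp: independent_modulo_def)
  define c' where "c' = (\<lambda>b. c b div int p)"
  have c: "c b = int p * c' b" if "b \<in> C" for b
    using dvd that by (simp add: c'_def)
  have "0 = of_nat p * (\<Sum>b\<in>C. of_int (c' b) * b)"
    using less.prems(1) by (simp add: c sum_distrib_left mult.assoc cong: sum.cong)
  hence rel: "(\<Sum>b\<in>C. of_int (c' b) * b) = 0" using \<open>p > 1\<close> by simp
  show ?case
  proof (cases "\<forall>b\<in>C. c b = 0")
    case False
    then obtain b0 where b0: "b0 \<in> C" "c b0 \<noteq> 0" by blast
    have le: "\<bar>c' b\<bar> \<le> \<bar>c b\<bar>" if "b \<in> C" for b
      using c[OF that] \<open>p > 1\<close> by (simp add: abs_mult mult_le_cancel_right1)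
    have "\<bar>c' b0\<bar> < \<bar>c b0\<bar>"
      using c[OF b0(1)] b0(2) \<open>p > 1\<close> by (simp add: abs_mult mult_less_cancel_right1)
    hence "(\<Sum>b\<in>C. \<bar>c' b\<bar>) < (\<Sum>b\<in>C. \<bar>c b\<bar>)"
      using sum_strict_mono_ex1[OF fin, of "\<lambda>b. \<bar>c' b\<bar>" "\<lambda>b. \<bar>c b\<bar>"] le b0(1) by blast
    moreover have "(\<Sum>b\<in>C. \<bar>c' b\<bar>) \<ge> 0" by (simp add: sum_nonneg)
    ultimately have "c' b = 0"
      using less.hyps[of c' b] rel less.prems(2) by linarith
    thus ?thesis using c less.prems(2) by simp
  qed (use less.prems in blast)
qed

text \<open>Independence modulo \<open>p\<close> implies independence over \<open>\<rat>\<close>, so the degree of the field is a bound.\<close>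

lemma independent_modulo_card_bound:
  assumes "number_field TYPE('f::field_char_0)" "p > 1"
  obtains d where "\<And>C :: 'f set. independent_modulo p C \<Longrightarrow> card C \<le> d"
proof -
  obtain d where d: "\<And>C :: 'f set. finite C \<Longrightarrow> card C > d \<Longrightarrow>
    \<exists>u :: 'f \<Rightarrow> rat. (\<Sum>b\<in>C. of_rat (u b) * b) = 0 \<and> (\<exists>b\<in>C. u b \<noteq> 0)"
    using number_field_dependent[OF assms(1)] by metis
  have "card C \<le> d" if C: "independent_modulo p C" for C :: "'f set"
  proof (rule ccontr)
    assume "\<not> card C \<le> d"
    moreover have fin: "finite C" using C by (simp add: independent_modulo_def)
    ultimately obtain u :: "'f \<Rightarrow> rat" and b where
      u: "(\<Sum>b\<in>C. of_rat (u b) * b) = 0" and b: "b \<in> C" "u b \<noteq> 0"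
      using d[of C] by auto
    obtain D :: nat where D: "D > 0" "\<forall>b\<in>C. \<exists>k::int. of_nat D * u b = of_int k"
      using common_denominator[OF fin] by blast
    then obtain c :: "'f \<Rightarrow> int" where c: "\<And>b. b \<in> C \<Longrightarrow> of_nat D * u b = of_int (c b)" by metis
    have "(\<Sum>b\<in>C. of_int (c b) * b) = of_nat D * (\<Sum>b\<in>C. of_rat (u b) * b)"
      unfolding sum_distrib_left
    proof (rule sum.cong)
      fix b assume "b \<in> C"
      have "(of_int (c b) :: 'f) = of_rat (of_nat D * u b)" using c[OF \<open>b \<in> C\<close>] by simp
      thus "of_int (c b) * b = of_nat D * (of_rat (u b) * b)"
        by (simp add: of_rat_mult mult.assoc)
    qed simp
    hence "c b = 0"
      using independent_modulo_relation_trivial[OF C \<open>p > 1\<close>] u b(1) by simp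
    thus False using c[OF b(1)] b(2) D(1) by simp
  qed
  thus ?thesis using that by blast
qed

text \<open>A set \<open>C\<close> of maximal size that is independent modulo \<open>p\<close> generates the residue ring over the
  field with \<open>p\<close> elements, and coefficients in \<open>{0..<p}\<close> suffice.\<close>

lemma finite_residues_prime:
  assumes "number_field TYPE('f::field_char_0)" and p: "prime p"
  shows "\<exists>T :: 'f set. finite T \<and> T \<subseteq> integers_of \<and>
    (\<forall>x\<in>integers_of. \<exists>t\<in>T. \<exists>y\<in>integers_of. x = t + of_nat p * y)"
proof -
  have p1: "p > 1" using p prime_gt_1_nat by blast
  obtain d where d: "\<And>C :: 'f set. independent_modulo p C \<Longrightarrow> card C \<le> d"
    using independent_modulo_card_bound[OF assms(1) p1] by metis
  have "independent_modulo p ({} :: 'f set)" by (simp add: independent_modulo_def)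
  \<comment> \<open>The principle of the greatest element takes a strict bound on the sizes, hence \<open>Suc d\<close>.\<close>
  then obtain C :: "'f set" where C: "independent_modulo p C"
    and maximal: "\<And>C' :: 'f set. independent_modulo p C' \<Longrightarrow> card C' \<le> card C"
    using ex_has_greatest_nat[of "independent_modulo p" "{} :: 'f set" card "Suc d"] d
    by (auto simp: less_Suc_eq_le)
  have fin: "finite C" and sub: "C \<subseteq> integers_of"
    and ind: "\<And>c :: 'f \<Rightarrow> int. (\<Sum>b\<in>C. of_int (c b) * b) \<in> (\<lambda>y. of_nat p * y) ` integers_of \<Longrightarrow>
      \<forall>b\<in>C. int p dvd c b"
    using C unfolding independent_modulo_def by blast+
  define T where "T = (\<lambda>c. \<Sum>b\<in>C. of_int (c b) * b) ` (C \<rightarrow>\<^sub>E {0..<int p})"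
  have "finite T" using fin by (simp add: T_def finite_PiE)
  moreover have "T \<subseteq> integers_of"
    using sub by (auto simp: T_def intro!: integers_of_sum integers_of_closed)
  moreover have "\<exists>t\<in>T. \<exists>y\<in>integers_of. x = t + of_nat p * y" if x: "x \<in> integers_of" for x
  proof -
    have "\<exists>c :: 'f \<Rightarrow> int. \<exists>y\<in>integers_of. x = (\<Sum>b\<in>C. of_int (c b) * b) + of_nat p * y"
    proof (cases "x \<in> C")
      case True
      have "(\<Sum>b\<in>C. of_int (if b = x then 1 else 0) * b) = (\<Sum>b\<in>C. if b = x then b else 0)"
        by (intro sum.cong) auto
      hence "x = (\<Sum>b\<in>C. of_int (if b = x then 1 else 0) * b) + of_nat p * 0"
        using True fin by simp
      thus ?thesis
        by (intro exI[of _ "\<lambda>b. if b = x then 1 else 0"] bexI[of _ 0]) (simp_all add: integers_of_0)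
    next
      case False
      hence "\<not> independent_modulo p (insert x C)"
        using maximal[of "insert x C"] fin by auto
      then obtain c :: "'f \<Rightarrow> int" and y where y: "y \<in> integers_of"
        and rel: "(\<Sum>b\<in>insert x C. of_int (c b) * b) = of_nat p * y"
        and nd: "\<not> (\<forall>b\<in>insert x C. int p dvd c b)"
        using fin sub x unfolding independent_modulo_def by auto
      have rel': "of_int (c x) * x + (\<Sum>b\<in>C. of_int (c b) * b) = of_nat p * y"
        using rel False fin by simp
      have "\<not> int p dvd c x"
      proof
        assume "int p dvd c x"
        then obtain k where k: "c x = int p * k" by (elim dvdE)
        have "(\<Sum>b\<in>C. of_int (c b) * b) = of_nat p * y - of_int (c x) * x"
          using rel' by (simp add: algebra_simps)
        also have "\<dots> = of_nat p * (y - of_int k * x)"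
          by (simp add: k algebra_simps)
        finally have "(\<Sum>b\<in>C. of_int (c b) * b) = of_nat p * (y - of_int k * x)" .
        moreover have "y - of_int k * x \<in> integers_of"
          using x y by (intro integers_of_closed)
        ultimately have "\<forall>b\<in>C. int p dvd c b"
          using ind[of c] by blast
        thus False using nd \<open>int p dvd c x\<close> by blast
      qed
      hence "coprime (int p) (c x)"
        using p by (simp add: prime_imp_coprime)
      \<comment> \<open>The coefficient of \<open>x\<close> is invertible modulo \<open>p\<close>; Bezout coefficients solve the relation for \<open>x\<close>.\<close>
      then obtain e k where ek: "e * int p + k * c x = 1"
        by (metis bezout_int coprime_iff_gcd_eq_1)
      have "x = of_int (e * int p + k * c x) * x" using ek by simp
      also have "\<dots> = of_nat p * (of_int e * x) + of_int k * (of_int (c x) * x)"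
        by (simp add: algebra_simps)
      also have "of_int (c x) * x = of_nat p * y - (\<Sum>b\<in>C. of_int (c b) * b)"
        using rel' by (simp add: algebra_simps)
      also have "of_nat p * (of_int e * x) + of_int k * (of_nat p * y - (\<Sum>b\<in>C. of_int (c b) * b))
          = (\<Sum>b\<in>C. of_int (- k * c b) * b) + of_nat p * (of_int e * x + of_int k * y)"
        by (simp add: algebra_simps sum_distrib_left sum_negf)
      finally have "x = (\<Sum>b\<in>C. of_int (- k * c b) * b) + of_nat p * (of_int e * x + of_int k * y)" .
      moreover have "of_int e * x + of_int k * y \<in> integers_of"
        using x y by (intro integers_of_closed)
      ultimately show ?thesis
        by (intro exI[of _ "\<lambda>b. - k * c b"]) blast
    qed
    then obtain c :: "'f \<Rightarrow> int" and y where y: "y \<in> integers_of"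
      and c: "x = (\<Sum>b\<in>C. of_int (c b) * b) + of_nat p * y" by blast
    define r where "r = (\<lambda>b\<in>C. c b mod int p)"
    define q where "q = (\<Sum>b\<in>C. of_int (c b div int p) * b)"
    have "(\<Sum>b\<in>C. of_int (c b) * b) = (\<Sum>b\<in>C. of_int (r b) * b) + of_nat p * q"
      unfolding q_def sum_distrib_left sum.distrib[symmetric]
    proof (rule sum.cong)
      fix b assume "b \<in> C"
      have "(of_int (c b) :: 'f) = of_int (c b mod int p + int p * (c b div int p))" by simp
      hence "(of_int (c b) :: 'f) = of_int (c b mod int p) + of_nat p * of_int (c b div int p)"
        by (simp only: of_int_add of_int_mult of_int_of_nat_eq)
      thus "of_int (c b) * b = of_int (r b) * b + of_nat p * (of_int (c b div int p) * b)"
        using \<open>b \<in> C\<close> by (simp add: r_def algebra_simps)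
    qed simp
    hence "x = (\<Sum>b\<in>C. of_int (r b) * b) + of_nat p * (q + y)"
      by (subst c) (simp add: algebra_simps)
    moreover have "(\<Sum>b\<in>C. of_int (r b) * b) \<in> T"
      using p1 unfolding T_def by (intro imageI) (auto simp: r_def)
    moreover have "q + y \<in> integers_of"
      using sub y by (auto simp: q_def intro!: integers_of_sum integers_of_closed)
    ultimately show ?thesis by blast
  qed
  ultimately show ?thesis by blast
qed

text \<open>Representatives modulo \<open>p m\<close> are \<open>s + p t\<close> with \<open>s\<close> running through representatives modulo \<open>p\<close>
  and \<open>t\<close> through representatives modulo \<open>m\<close>.\<close>

lemma finite_residues:
  assumes "number_field TYPE('f::field_char_0)" and "n > 0"
  obtains T :: "'f::field_char_0 set" where "finite T" "T \<subseteq> integers_of"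
    "\<And>x. x \<in> integers_of \<Longrightarrow> \<exists>t\<in>T. \<exists>y\<in>integers_of. x = t + of_nat n * y"
proof -
  have "\<exists>T :: 'f set. finite T \<and> T \<subseteq> integers_of \<and>
    (\<forall>x\<in>integers_of. \<exists>t\<in>T. \<exists>y\<in>integers_of. x = t + of_nat n * y)"
    using \<open>n > 0\<close>
  proof (induction n rule: less_induct)
    case (less n)
    show ?case
    proof (cases "n = 1")
      case True
      thus ?thesis by (intro exI[of _ "{0}"]) (auto simp: integers_of_0)
    next
      case False
      then obtain p where p: "prime p" "p dvd n" using prime_factor_nat by blast
      then obtain m where m: "n = p * m" by (elim dvdE)
      have "m < n" "m > 0"
        using m less.prems prime_gt_1_nat[OF p(1)] by auto
      obtain T' :: "'f set" where T': "finite T'" "T' \<subseteq> integers_of"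
        "\<forall>x\<in>integers_of. \<exists>t\<in>T'. \<exists>y\<in>integers_of. x = t + of_nat m * y"
        using less.IH[OF \<open>m < n\<close> \<open>m > 0\<close>] by (elim exE conjE)
      obtain T :: "'f set" where T: "finite T" "T \<subseteq> integers_of"
        "\<forall>x\<in>integers_of. \<exists>t\<in>T. \<exists>y\<in>integers_of. x = t + of_nat p * y"
        using finite_residues_prime[OF assms(1) p(1)] by (elim exE conjE)
      let ?T = "(\<lambda>(s, t). s + of_nat p * t) ` (T \<times> T')"
      have "\<exists>t\<in>?T. \<exists>y\<in>integers_of. x = t + of_nat n * y" if x: "x \<in> integers_of" for x
      proof -
        obtain t y where t: "t \<in> T" "y \<in> integers_of" "x = t + of_nat p * y" using T(3) x by blast
        obtain t' y' where t': "t' \<in> T'" "y' \<in> integers_of" "y = t' + of_nat m * y'"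
          using T'(3) t(2) by blast
        have "x = (t + of_nat p * t') + of_nat n * y'"
          using t(3) t'(3) m by (simp add: algebra_simps)
        thus ?thesis using t t' by force
      qed
      moreover have "finite ?T" "?T \<subseteq> integers_of"
        using T T' by (auto intro!: integers_of_closed)
      ultimately show ?thesis by blast
    qed
  qed
  thus ?thesis using that by blast
qed

section \<open>Integral closedness and annihilators modulo an integer\<close>

text \<open>Up to sign, \<open>N\<close> is the lowest nonzero coefficient of a monic integer polynomial vanishing at \<open>x\<close>;
  all the other terms, after division by a power of \<open>x\<close>, are multiples of \<open>x\<close>.\<close>

lemma integer_divides_nat:
  fixes x :: "'f::field_char_0"
  assumes "x \<in> integers_of" "x \<noteq> 0"
  obtains N :: nat and w where "N > 0" "w \<in> integers_of" "of_nat N = x * w"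
proof -
  have "\<exists>k::int. k \<noteq> 0 \<and> (\<exists>w\<in>integers_of. of_int k = x * w)"
    if "lead_coeff p = 1" "poly (map_poly of_int p) x = 0" for p :: "int poly"
    using that
  proof (induction p)
    case (pCons a p)
    have eq: "of_int a + x * poly (map_poly of_int p) x = 0"
      using pCons.prems(2) pCons.hyps by (simp add: map_poly_pCons)
    show ?case
    proof (cases "a = 0")
      case True
      hence "poly (map_poly of_int p) x = 0" using eq \<open>x \<noteq> 0\<close> by simp
      thus ?thesis using pCons True by auto
    next
      case False
      have "poly (map_poly of_int p) x \<in> integers_of"
        unfolding poly_altdef using assms
        by (intro integers_of_sum integers_of_mult integers_of_power) (simp_all add: integers_of_of_int coeff_map_poly)
      moreover have "of_int (- a) = x * poly (map_poly of_int p) x"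
        using eq by (simp add: add_eq_0_iff)
      ultimately show ?thesis using False by (metis neg_equal_0_iff_equal)
    qed
  qed simp
  moreover obtain p where "lead_coeff p = 1" "poly (map_poly of_int p) x = 0"
    using assms(1) unfolding integers_of_def algebraic_int_altdef_ipoly by auto
  ultimately obtain k :: int and w where k: "k \<noteq> 0" "w \<in> integers_of" "of_int k = x * w"
    by blast
  show ?thesis
  proof (cases "k > 0")
    case True
    thus ?thesis using that[of "nat k" w] k by simp
  next
    case False
    have "of_nat (nat (- k)) = (of_int (- k) :: 'f)" using False by (subst of_nat_nat) auto
    thus ?thesis
      using that[of "nat (- k)" "- w"] k False by (simp add: integers_of_minus)
  qed
qed

text \<open>Pigeonhole principle: replacing \<open>c\<close> by a positive integer \<open>N\<close>, two of the integers \<open>N y\<^sup>n\<close> agree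
  modulo \<open>N\<close>. So \<open>y\<^sup>j - y\<^sup>i\<close> is an integer for some \<open>i < j\<close>, and \<open>y\<close> is a root of a monic polynomial with
  integral coefficients.\<close>

lemma integers_completely_integrally_closed:
  fixes c y :: "'f::field_char_0"
  assumes nf: "number_field TYPE('f)" and c: "c \<in> integers_of" "c \<noteq> 0"
    and pow: "\<And>n. c * y ^ n \<in> integers_of"
  shows "y \<in> integers_of"
proof -
  obtain N w where N: "N > 0" "w \<in> integers_of" "of_nat N = c * w"
    using integer_divides_nat[OF c] by metis
  have Npow: "of_nat N * y ^ n \<in> integers_of" for n
    using integers_of_mult[OF N(2) pow[of n]] N(3) by (simp add: mult_ac)
  obtain T :: "'f set" where T: "finite T"
    "\<And>x. x \<in> integers_of \<Longrightarrow> \<exists>t\<in>T. \<exists>y\<in>integers_of. x = t + of_nat N * y"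
    using finite_residues[OF nf N(1)] by metis
  obtain t where t: "\<And>n. t n \<in> T" "\<And>n. \<exists>z\<in>integers_of. of_nat N * y ^ n = t n + of_nat N * z"
    using T(2)[OF Npow] by metis
  have "range t \<subseteq> T" using t(1) by blast
  hence "\<not> inj t"
    using T(1) finite_imageD finite_subset infinite_UNIV_nat by blast
  then obtain i j where "t i = t j" "i \<noteq> j" by (auto simp: inj_on_def)
  then obtain i j where ij: "t i = t j" "i < j" by (metis nat_neq_iff)
  obtain z z' where z: "z \<in> integers_of" "of_nat N * y ^ i = t i + of_nat N * z"
      "z' \<in> integers_of" "of_nat N * y ^ j = t j + of_nat N * z'"
    using t(2) by meson
  have "of_nat N * (y ^ j - y ^ i) = of_nat N * (z' - z)"
    using z ij by (simp add: algebra_simps)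
  hence eq: "y ^ j - y ^ i = z' - z" using N(1) by simp
  define p :: "'f poly" where "p = monom 1 j - monom 1 i"
  have deg: "degree p = j"
    unfolding p_def using ij(2)
    by (subst degree_add_eq_left[of "- monom 1 i", simplified]) (simp_all add: degree_monom_eq)
  have "algebraic_int y"
  proof (rule algebraic_int_root)
    show "algebraic_int (z' - z)" using integers_of_diff[OF z(3,1)] by (simp add: integers_of_def)
    show "poly p y = z' - z" using eq by (simp add: p_def poly_monom)
    show "\<forall>i. coeff p i \<in> \<int>" by (simp add: p_def)
    show "lead_coeff p = 1" using deg ij(2) by (simp add: p_def)
    show "degree p > 0" using deg ij(2) by simp
  qed
  thus ?thesis by (simp add: integers_of_def)
qed

text \<open>This provides an element of \<open>K\<^sup>-\<^sup>1\<close> outside the ring of integers for each proper ideal \<open>K\<close>. Modulo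
  \<open>N\<close>, where the ring is finite, choose \<open>c\<close> with \<open>c \<notin> c K\<close> such that the ideal generated by \<open>c\<close> is as
  small as possible. For \<open>x \<in> K\<close> the ideal of \<open>c x\<close> is strictly smaller, whence \<open>c x \<in> c x K\<close>, that is,
  \<open>c (1 - k) x = 0\<close> with \<open>k \<in> K\<close>. But \<open>c (1 - k)\<close> has the property that \<open>c\<close> has, so it generates the
  same ideal as \<open>c\<close>, and \<open>c x = 0\<close>. Thus \<open>c\<close> annihilates \<open>K\<close> modulo \<open>N\<close>, and \<open>y = c / N\<close> is as desired.\<close>

lemma proper_ideal_annihilated_modulo:
  fixes K :: "'f::field_char_0 set"
  assumes nf: "number_field TYPE('f)" and "K \<subseteq> integers_of"
    and add: "\<And>x y. x \<in> K \<Longrightarrow> y \<in> K \<Longrightarrow> x + y \<in> K"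
    and mult: "\<And>a x. a \<in> integers_of \<Longrightarrow> x \<in> K \<Longrightarrow> a * x \<in> K"
    and "1 \<notin> K" and N: "N > 0" "of_nat N \<in> K"
  obtains y where "y \<notin> integers_of" "\<And>x. x \<in> K \<Longrightarrow> y * x \<in> integers_of"
proof -
  obtain T :: "'f set" where T: "finite T" "T \<subseteq> integers_of"
    "\<And>x. x \<in> integers_of \<Longrightarrow> \<exists>t\<in>T. \<exists>y\<in>integers_of. x = t + of_nat N * y"
    using finite_residues[OF nf N(1)] by metis
  define good where "good = (\<lambda>c. c \<in> integers_of \<and>
    \<not> (\<exists>k\<in>K. \<exists>z\<in>integers_of. c = c * k + of_nat N * z))"
  \<comment> \<open>Ideals containing \<open>N\<close> are measured by the number of chosen residues that they contain.\<close>
  define gen where "gen = (\<lambda>c :: 'f. {c * a + of_nat N * z | a z. a \<in> integers_of \<and> z \<in> integers_of})"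
  have "good 1"
    unfolding good_def
  proof (intro conjI notI; (elim bexE)?)
    fix k z assume kz: "k \<in> K" "z \<in> integers_of" "1 = 1 * k + of_nat N * z"
    have "k + z * of_nat N \<in> K" using kz N by (intro add mult)
    thus False using kz(3) \<open>1 \<notin> K\<close> by (simp add: mult.commute)
  qed (rule integers_of_1)
  then obtain c where c: "good c" and min: "\<And>c'. good c' \<Longrightarrow> card (T \<inter> gen c) \<le> card (T \<inter> gen c')"
    using ex_has_least_nat[of good 1 "\<lambda>c. card (T \<inter> gen c)"] by blast
  have cO: "c \<in> integers_of" using c by (simp add: good_def)
  have gen_mult: "gen (c * a) \<subseteq> gen c" if "a \<in> integers_of" for a
  proof
    fix x assume "x \<in> gen (c * a)"
    then obtain b z where "b \<in> integers_of" "z \<in> integers_of" "x = c * a * b + of_nat N * z"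
      by (auto simp: gen_def)
    thus "x \<in> gen c"
      using integers_of_mult[OF that] unfolding gen_def by (auto simp: mult.assoc)
  qed
  \<comment> \<open>By minimality a good multiple of \<open>c\<close> generates the same ideal modulo \<open>N\<close>.\<close>
  have in_gen: "c \<in> gen (c * a)" if a: "a \<in> integers_of" and g: "good (c * a)" for a
  proof -
    have sub: "T \<inter> gen (c * a) \<subseteq> T \<inter> gen c" using gen_mult[OF a] by blast
    hence eq: "T \<inter> gen (c * a) = T \<inter> gen c"
      using T(1) min[OF g] by (intro card_seteq[OF _ sub]) auto
    obtain t z where t: "t \<in> T" "z \<in> integers_of" "c = t + of_nat N * z" using T(3)[OF cO] by blast
    have "t = c * 1 + of_nat N * (- z)" using t(3) by simp
    hence "t \<in> gen c"
      unfolding gen_def using t(2) integers_of_1 integers_of_minus by blast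
    hence "t \<in> gen (c * a)" using eq t(1) by blast
    then obtain b z' where "b \<in> integers_of" "z' \<in> integers_of" "t = c * a * b + of_nat N * z'"
      by (auto simp: gen_def)
    hence "c = c * a * b + of_nat N * (z' + z)" using t(3) by (simp add: algebra_simps)
    thus ?thesis
      unfolding gen_def using \<open>b \<in> _\<close> \<open>z' \<in> _\<close> t(2) integers_of_add by blast
  qed
  have ann: "\<exists>z\<in>integers_of. c * x = of_nat N * z" if x: "x \<in> K" for x
  proof -
    have xO: "x \<in> integers_of" using x assms(2) by blast
    have "\<not> good (c * x)"
    proof
      assume "good (c * x)"
      then obtain a z where a: "a \<in> integers_of" "z \<in> integers_of" "c = c * x * a + of_nat N * z"
        using in_gen[OF xO] by (auto simp: gen_def)
      have "c = c * (a * x) + of_nat N * z" using a(3) by (simp add: mult_ac)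
      thus False using c mult[OF a(1) x] a(2) unfolding good_def by blast
    qed
    then obtain k z where k: "k \<in> K" "z \<in> integers_of" "c * x = c * x * k + of_nat N * z"
      using integers_of_mult[OF cO xO] by (auto simp: good_def)
    have kO: "1 - k \<in> integers_of" using k(1) assms(2) integers_of_diff integers_of_1 by blast
    have kill: "c * (1 - k) * x = of_nat N * z" using k(3) by (simp add: algebra_simps)
    have "good (c * (1 - k))"
      unfolding good_def
    proof (intro conjI notI; (elim bexE)?)
      fix l u assume l: "l \<in> K" "u \<in> integers_of" "c * (1 - k) = c * (1 - k) * l + of_nat N * u"
      have "c = c * (k + (1 - k) * l) + of_nat N * u"
        using l(3) by (simp add: algebra_simps)
      moreover have "k + (1 - k) * l \<in> K" using k(1) l(1) kO by (intro add mult)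
      ultimately show False using c l(2) unfolding good_def by blast
    qed (use cO kO integers_of_mult in blast)
    then obtain a u where a: "a \<in> integers_of" "u \<in> integers_of" "c = c * (1 - k) * a + of_nat N * u"
      using in_gen[OF kO] by (auto simp: gen_def)
    have "c * x = (c * (1 - k) * a + of_nat N * u) * x" using a(3) by simp
    also have "\<dots> = a * (c * (1 - k) * x) + of_nat N * u * x" by (simp add: algebra_simps)
    also have "\<dots> = of_nat N * (a * z + u * x)"
      unfolding kill by (simp add: algebra_simps)
    finally have "c * x = of_nat N * (a * z + u * x)" .
    thus ?thesis using a k(2) xO by (meson integers_of_add integers_of_mult)
  qed
  show ?thesis
  proof (rule that[of "c / of_nat N"])
    show "c / of_nat N \<notin> integers_of"
    proof
      assume "c / of_nat N \<in> integers_of"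
      moreover have "c = c * of_nat N + of_nat N * (c / of_nat N - c)"
        using N(1) by (simp add: algebra_simps)
      ultimately show False
        using c cO N(2) integers_of_diff unfolding good_def by blast
    qed
    show "c / of_nat N * x \<in> integers_of" if "x \<in> K" for x
      using ann[OF that] N(1) by auto
  qed
qed

section \<open>Inverses of fractional ideals\<close>

definition ideal_inverse :: "'f::field_char_0 set \<Rightarrow> 'f set" where
  "ideal_inverse I = {y. \<forall>x\<in>I. y * x \<in> integers_of}"

lemma fractional_idealD:
  assumes "fractional_ideal I"
  shows "0 \<in> I" "x \<in> I \<Longrightarrow> y \<in> I \<Longrightarrow> x + y \<in> I" "a \<in> integers_of \<Longrightarrow> x \<in> I \<Longrightarrow> a * x \<in> I"
    "x \<in> I \<Longrightarrow> - x \<in> I"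
proof -
  show *: "a \<in> integers_of \<Longrightarrow> x \<in> I \<Longrightarrow> a * x \<in> I" for a x
    using assms unfolding fractional_ideal_def by blast
  show "x \<in> I \<Longrightarrow> - x \<in> I"
    using *[of "- 1"] integers_of_of_int[of "- 1"] by simp
qed (use assms in \<open>auto simp: fractional_ideal_def\<close>)

lemma fractional_ideal_nonzero:
  assumes "fractional_ideal I"
  obtains x where "x \<in> I" "x \<noteq> 0"
  using assms unfolding fractional_ideal_def by blast

lemma fractional_ideal_denominator:
  assumes "fractional_ideal I"
  obtains d where "d \<in> integers_of" "d \<noteq> 0" "\<And>x. x \<in> I \<Longrightarrow> d * x \<in> integers_of"
  using assms unfolding fractional_ideal_def by blast

lemma fractional_ideal_contains_nat:
  fixes I :: "'f::field_char_0 set"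
  assumes "fractional_ideal I"
  obtains N :: nat where "N > 0" "of_nat N \<in> I"
proof -
  obtain d where d: "d \<in> integers_of" "d \<noteq> 0" "\<And>x. x \<in> I \<Longrightarrow> d * x \<in> integers_of"
    using fractional_ideal_denominator[OF assms] by metis
  obtain x where x: "x \<in> I" "x \<noteq> 0" using fractional_ideal_nonzero[OF assms] by metis
  obtain N w where N: "N > 0" "w \<in> integers_of" "of_nat N = (d * x) * w"
    using integer_divides_nat[of "d * x"] d x by (metis mult_eq_0_iff)
  have "(d * w) * x \<in> I"
    using fractional_idealD(3)[OF assms] integers_of_mult[OF d(1) N(2)] x(1) by blast
  hence "of_nat N \<in> I" using N(3) by (simp add: mult_ac)
  thus ?thesis using that N(1) by blast
qed

lemma fractional_ideal_ideal_inverse: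
  assumes "fractional_ideal I"
  shows "fractional_ideal (ideal_inverse I)"
proof -
  obtain d where d: "d \<in> integers_of" "d \<noteq> 0" "\<And>x. x \<in> I \<Longrightarrow> d * x \<in> integers_of"
    using fractional_ideal_denominator[OF assms] by metis
  obtain N where N: "N > 0" "of_nat N \<in> I" using fractional_ideal_contains_nat[OF assms] .
  have "ideal_inverse I \<noteq> {0}" using d by (auto simp: ideal_inverse_def)
  moreover have "\<forall>x\<in>ideal_inverse I. of_nat N * x \<in> integers_of"
    using N(2) by (auto simp: ideal_inverse_def mult.commute)
  moreover have "\<forall>x\<in>ideal_inverse I. \<forall>y\<in>ideal_inverse I. x + y \<in> ideal_inverse I"
    "\<forall>a\<in>integers_of. \<forall>x\<in>ideal_inverse I. a * x \<in> ideal_inverse I"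
    by (auto simp: ideal_inverse_def distrib_right mult.assoc integers_of_add integers_of_mult)
  moreover have "0 \<in> ideal_inverse I" by (simp add: ideal_inverse_def integers_of_0)
  ultimately show ?thesis
    unfolding fractional_ideal_def using N(1) integers_of_of_nat[of N] of_nat_neq_0
    by (intro conjI bexI[of _ "of_nat N"]) auto
qed

text \<open>With \<open>J = I\<^sup>-\<^sup>1\<close>, an element \<open>y\<close> with \<open>y I J \<subseteq> O\<close> satisfies \<open>y J \<subseteq> J\<close>, so its powers have a common
  denominator and it is an integer. Hence the ideal \<open>I J\<close> is not proper, and \<open>1 = \<Sum> x\<^sub>i y\<^sub>i\<close> with \<open>x\<^sub>i \<in> I\<close>
  and \<open>y\<^sub>i \<in> J\<close>. If \<open>z J \<subseteq> O\<close>, then \<open>z = \<Sum> (z y\<^sub>i) x\<^sub>i\<close> lies in \<open>I\<close>.\<close>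

lemma ideal_inverse_inverse:
  fixes I :: "'f::field_char_0 set"
  assumes nf: "number_field TYPE('f)" and I: "fractional_ideal I"
  shows "ideal_inverse (ideal_inverse I) = I"
proof
  show "I \<subseteq> ideal_inverse (ideal_inverse I)"
    by (auto simp: ideal_inverse_def mult.commute)
next
  let ?J = "ideal_inverse I"
  let ?K = "ideal_prod class_ring I ?J"
  have J: "fractional_ideal ?J" by (rule fractional_ideal_ideal_inverse[OF I])
  have prod: "x * y \<in> ?K" if "x \<in> I" "y \<in> ?J" for x y
    using ideal_prod.prod[of x I y ?J "class_ring"] that by simp
  have KO: "x \<in> integers_of" if "x \<in> ?K" for x
    using that by induction (auto simp: ideal_inverse_def mult.commute intro: integers_of_add)
  have Kadd: "x + y \<in> ?K" if "x \<in> ?K" "y \<in> ?K" for x y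
    using ideal_prod.sum[OF that] by simp
  have Kmult: "a * x \<in> ?K" if "x \<in> ?K" "a \<in> integers_of" for a x
    using that
  proof (induction)
    case (prod i j)
    have "(a * i) * j \<in> ?K"
      using fractional_idealD(3)[OF I] prod \<open>\<And>y x. x \<in> I \<Longrightarrow> y \<in> ?J \<Longrightarrow> x * y \<in> ?K\<close> by blast
    thus ?case by (simp add: mult.assoc)
  qed (simp add: distrib_left Kadd)
  obtain N where N: "N > 0" "of_nat N \<in> I" using fractional_ideal_contains_nat[OF I] .
  obtain M where M: "M > 0" "of_nat M \<in> ?J" using fractional_ideal_contains_nat[OF J] .
  have NM: "of_nat (N * M) \<in> ?K" using prod[OF N(2) M(2)] by simp
  have "1 \<in> ?K"
  proof (rule ccontr)
    assume "1 \<notin> ?K"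
    obtain y where y: "y \<notin> integers_of" "\<And>x. x \<in> ?K \<Longrightarrow> y * x \<in> integers_of"
      by (rule proper_ideal_annihilated_modulo[OF nf, of ?K "N * M"])
        (use KO Kadd Kmult N(1) M(1) NM \<open>1 \<notin> ?K\<close> in auto)
    have yJ: "y * x \<in> ?J" if "x \<in> ?J" for x
    proof -
      have "(y * x) * z \<in> integers_of" if "z \<in> I" for z
        using y(2)[OF prod[OF that \<open>x \<in> ?J\<close>]] by (simp add: mult_ac)
      thus ?thesis by (simp add: ideal_inverse_def)
    qed
    have yn: "y ^ n * of_nat M \<in> ?J" for n
      by (induction n) (use M(2) yJ in \<open>auto simp: mult.assoc\<close>)
    have "of_nat (M * N) * y ^ n \<in> integers_of" for n
      using yn[of n] N(2) by (auto simp: ideal_inverse_def mult_ac)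
    thus False
      using integers_completely_integrally_closed[OF nf, of "of_nat (M * N)" y] y(1) N(1) M(1)
        integers_of_of_nat[of "M * N"] by auto
  qed
  moreover have "z * k \<in> I" if "k \<in> ?K" "z \<in> ideal_inverse ?J" for z k
    using that
  proof (induction)
    case (prod i j)
    hence "(z * j) * i \<in> I"
      by (intro fractional_idealD(3)[OF I]) (auto simp: ideal_inverse_def)
    thus ?case by (simp add: mult_ac)
  qed (simp add: distrib_left fractional_idealD(2)[OF I])
  ultimately show "ideal_inverse ?J \<subseteq> I" by fastforce
qed

section \<open>Nonnegative parts of fractional ideals\<close>

lemma of_nat_in_nonneg_part:
  fixes I :: "'f::field_char_0 set"
  assumes hom: "\<forall>\<sigma>\<in>S. field_hom (\<sigma> :: 'f \<Rightarrow> real)" and "of_nat N \<in> I"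
  shows "of_nat N \<in> nonneg_part S I"
proof -
  have "\<sigma> (of_nat N) \<ge> 0" if "\<sigma> \<in> S" for \<sigma>
  proof -
    interpret field_hom \<sigma> using hom that by blast
    show ?thesis by (simp add: hom_distribs)
  qed
  thus ?thesis using assms(2) by (simp add: nonneg_part_def)
qed

text \<open>The ideal contains an element that is totally at least \<open>\<bar>x\<bar>\<close>: clearing the denominator of \<open>x\<close> by
  a positive integer \<open>D\<close>, the element \<open>N ((D x)\<^sup>2 + 1)\<close> lies in \<open>I\<close> for each positive integer \<open>N\<close> in
  \<open>I\<close>, and \<open>\<bar>s\<bar> \<le> s\<^sup>2 + 1\<close> for real \<open>s\<close>.\<close>

lemma fractional_ideal_positive_difference:
  fixes I :: "'f::field_char_0 set"
  assumes hom: "\<forall>\<sigma>\<in>S. field_hom (\<sigma> :: 'f \<Rightarrow> real)" and I: "fractional_ideal I" and x: "x \<in> I"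
  obtains u v where "u \<in> nonneg_part S I" "v \<in> nonneg_part S I" "x = u - v"
proof -
  obtain d where d: "d \<in> integers_of" "d \<noteq> 0" "\<And>x. x \<in> I \<Longrightarrow> d * x \<in> integers_of"
    using fractional_ideal_denominator[OF I] by metis
  obtain D w where D: "D > 0" "w \<in> integers_of" "of_nat D = d * w"
    using integer_divides_nat[OF d(1,2)] by metis
  obtain N where N: "N > 0" "of_nat N \<in> I" using fractional_ideal_contains_nat[OF I] .
  define y where "y = of_nat D * x"
  have "y \<in> integers_of"
    using integers_of_mult[OF D(2) d(3)[OF x]] by (simp add: y_def D(3) mult_ac)
  define v where "v = (y ^ 2 + 1) * of_nat N"
  have v: "v \<in> I"
    unfolding v_def
    by (intro fractional_idealD(3)[OF I] integers_of_add integers_of_power integers_of_1 \<open>y \<in> _\<close> N(2))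
  have pos: "\<sigma> v \<ge> 0 \<and> \<sigma> (x + v) \<ge> 0" if "\<sigma> \<in> S" for \<sigma>
  proof -
    interpret field_hom \<sigma> using hom that by blast
    let ?s = "\<sigma> x"
    have sv: "\<sigma> v = ((real D * ?s) ^ 2 + 1) * real N"
      by (simp add: v_def y_def hom_distribs)
    have "0 \<le> (\<bar>?s\<bar> - 1) ^ 2" by simp
    hence "\<bar>?s\<bar> \<le> ?s ^ 2 + 1" by (simp add: power2_eq_square algebra_simps abs_mult_self_eq)
    also have "?s ^ 2 \<le> real D ^ 2 * ?s ^ 2"
      using D(1) by (intro mult_right_le_one_le[THEN order_trans] mult_le_cancel_right1[THEN iffD2]) auto
    also have "real D ^ 2 * ?s ^ 2 + 1 \<le> (real D ^ 2 * ?s ^ 2 + 1) * real N"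
      using mult_left_mono[of 1 "real N" "real D ^ 2 * ?s ^ 2 + 1"] N(1) by simp
    finally have "\<bar>?s\<bar> \<le> \<sigma> v" by (simp add: sv power_mult_distrib)
    thus ?thesis by (auto simp: hom_distribs)
  qed
  show ?thesis
    by (rule that[of "x + v" v])
       (use x v pos fractional_idealD(2)[OF I] in \<open>auto simp: nonneg_part_def\<close>)
qed

text \<open>If \<open>y I\<^sub>+\<close> consists of integers then so does \<open>y I\<close>, because \<open>I\<^sub>+\<close> generates \<open>I\<close>; and \<open>y\<close> is nonnegative
  because its product with a positive integer in \<open>I\<close> is.\<close>

lemma positive_dual:
  fixes I :: "'f::field_char_0 set"
  assumes hom: "\<forall>\<sigma>\<in>S. field_hom (\<sigma> :: 'f \<Rightarrow> real)" and I: "fractional_ideal I"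
  shows "{y. \<forall>x\<in>nonneg_part S I. y * x \<in> nonneg_part S integers_of} =
    nonneg_part S (ideal_inverse I)" (is "?L = ?R")
proof
  obtain N where N: "N > 0" "of_nat N \<in> I" using fractional_ideal_contains_nat[OF I] .
  show "?L \<subseteq> ?R"
  proof
    fix y assume y: "y \<in> ?L"
    have "y * x \<in> integers_of" if x: "x \<in> I" for x
    proof -
      obtain u v where uv: "u \<in> nonneg_part S I" "v \<in> nonneg_part S I" "x = u - v"
        using fractional_ideal_positive_difference[OF hom I x] .
      have "y * u \<in> integers_of" "y * v \<in> integers_of"
        using y uv by (auto simp: nonneg_part_def)
      thus ?thesis using uv(3) by (simp add: right_diff_distrib integers_of_diff)
    qed
    moreover have "\<sigma> y \<ge> 0" if "\<sigma> \<in> S" for \<sigma>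
    proof -
      interpret field_hom \<sigma> using hom that by blast
      have "of_nat N \<in> nonneg_part S I" by (rule of_nat_in_nonneg_part[OF hom N(2)])
      hence "\<sigma> (y * of_nat N) \<ge> 0" using y that by (auto simp: nonneg_part_def)
      thus ?thesis using N(1) by (simp add: hom_distribs zero_le_mult_iff)
    qed
    ultimately show "y \<in> ?R" by (simp add: nonneg_part_def ideal_inverse_def)
  qed
  show "?R \<subseteq> ?L"
  proof
    fix y assume y: "y \<in> ?R"
    have "\<sigma> (y * x) \<ge> 0" if "x \<in> nonneg_part S I" "\<sigma> \<in> S" for x \<sigma>
    proof -
      interpret field_hom \<sigma> using hom that by blast
      show ?thesis using that y by (auto simp: nonneg_part_def hom_distribs)
    qed
    thus "y \<in> ?L" using y by (auto simp: nonneg_part_def ideal_inverse_def)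
  qed
qed

section \<open>Modules over a semiring whose differences have the field as quotients\<close>

text \<open>The last condition says that \<open>x = (u - v) / n\<close>. It is stated without subtraction and division
  because both sides then make sense after applying an additive and homogeneous map.\<close>

locale fraction_subsemiring =
  fixes C :: "'f::field set"
  assumes zero_mem: "0 \<in> C" and one_mem: "1 \<in> C"
    and add_mem: "x \<in> C \<Longrightarrow> y \<in> C \<Longrightarrow> x + y \<in> C"
    and mult_mem: "x \<in> C \<Longrightarrow> y \<in> C \<Longrightarrow> x * y \<in> C"
    and fraction: "\<exists>u\<in>C. \<exists>v\<in>C. \<exists>n\<in>C. n \<noteq> 0 \<and> n * x + v = u"
begin

definition scalars :: "'f ring" where
  "scalars = class_ring\<lparr>carrier := C\<rparr>"

lemma scalars_simps [simp]:
  "carrier scalars = C" "Group.mult scalars = (*)" "\<one>\<^bsub>scalars\<^esub> = 1" "Ring.add scalars = (+)" "\<zero>\<^bsub>scalars\<^esub> = 0"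
  by (simp_all add: scalars_def)

abbreviation functionals :: "('f, 'b) module \<Rightarrow> ('b \<Rightarrow> 'f) set" where
  "functionals L \<equiv> LinearCombinations.module_hom scalars L (regular_module class_ring)"

lemma functionals_iff:
  "\<phi> \<in> functionals L \<longleftrightarrow>
    (\<forall>x\<in>carrier L. \<forall>y\<in>carrier L. \<phi> (x \<oplus>\<^bsub>L\<^esub> y) = \<phi> x + \<phi> y) \<and>
    (\<forall>a\<in>C. \<forall>x\<in>carrier L. \<phi> (a \<odot>\<^bsub>L\<^esub> x) = a * \<phi> x)"
  by (auto simp: LinearCombinations.module_hom_def regular_module_def)

lemma functional_add:
    "\<phi> \<in> functionals L \<Longrightarrow> x \<in> carrier L \<Longrightarrow> y \<in> carrier L \<Longrightarrow> \<phi> (x \<oplus>\<^bsub>L\<^esub> y) = \<phi> x + \<phi> y"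
  and functional_smult:
    "\<phi> \<in> functionals L \<Longrightarrow> a \<in> C \<Longrightarrow> x \<in> carrier L \<Longrightarrow> \<phi> (a \<odot>\<^bsub>L\<^esub> x) = a * \<phi> x"
  unfolding functionals_iff by blast+

text \<open>Maps into the semiring are regarded as maps into the field with restricted values.\<close>

lemma carrier_dual:
  "carrier (dual scalars L) = {\<phi> \<in> functionals L. (\<forall>x\<in>carrier L. \<phi> x \<in> C) \<and> \<phi> \<in> extensional (carrier L)}"
  by (auto simp: dual_def LinearCombinations.module_hom_def regular_module_def)

lemma csemiring_scalars: "csemiring scalars"
proof -
  have "Group.comm_monoid scalars"
    by (rule Group.comm_monoidI) (auto simp: zero_mem one_mem add_mem mult_mem)
  moreover have "abelian_monoid scalars"
    by (rule abelian_monoidI) (auto simp: zero_mem one_mem add_mem mult_mem)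
  moreover have "Ring.semiring scalars"
    by (rule Ring.semiring.intro) (use calculation in
      \<open>auto simp: Group.comm_monoid_def Ring.semiring_axioms_def algebra_simps\<close>)
  ultimately show ?thesis by (simp add: csemiring_def)
qed

lemma functional_zero:
  assumes "semimodule scalars L" "\<phi> \<in> functionals L"
  shows "\<phi> \<zero>\<^bsub>L\<^esub> = 0"
proof -
  interpret semimodule scalars L by fact
  have "\<phi> \<zero>\<^bsub>L\<^esub> = \<phi> (0 \<odot>\<^bsub>L\<^esub> \<zero>\<^bsub>L\<^esub>)" using smult_l_null[of "\<zero>\<^bsub>L\<^esub>"] by simp
  also have "\<dots> = 0 * \<phi> \<zero>\<^bsub>L\<^esub>"
    using assms(2) zero_mem M.zero_closed unfolding functionals_iff by blast
  finally show ?thesis by simp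
qed

lemma functional_range_closed:
  assumes "semimodule scalars L" "f \<in> functionals L" "m \<in> f ` carrier L" 
  shows "m' \<in> f ` carrier L \<Longrightarrow> m + m' \<in> f ` carrier L" "a \<in> C \<Longrightarrow> a * m \<in> f ` carrier L"
proof -
  interpret semimodule scalars L by fact
  show "m + m' \<in> f ` carrier L" if m': "m' \<in> f ` carrier L"
  proof -
    obtain x where x: "x \<in> carrier L" "m = f x" using assms(3) by blast
    obtain y where y: "y \<in> carrier L" "m' = f y" using m' by blast
    have "m + m' = f (x \<oplus>\<^bsub>L\<^esub> y)"
      unfolding x(2) y(2) by (rule functional_add[OF assms(2) x(1) y(1), symmetric])
    thus ?thesis using M.a_closed[OF x(1) y(1)] by (rule image_eqI)
  qed
  show "a * m \<in> f ` carrier L" if "a \<in> C"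
  proof -
    obtain x where x: "x \<in> carrier L" "m = f x" using assms(3) by blast
    have "a * m = f (a \<odot>\<^bsub>L\<^esub> x)"
      unfolding x(2) by (rule functional_smult[OF assms(2) that x(1), symmetric])
    moreover have "a \<odot>\<^bsub>L\<^esub> x \<in> carrier L" using smult_closed[of a x] x that by simp
    ultimately show ?thesis by (rule image_eqI)
  qed
qed

text \<open>Fix \<open>m' \<noteq> 0\<close> in \<open>M\<close>. From \<open>n (m / m') + v = u\<close> one gets the relation \<open>n m + v m' = u m'\<close> in
  \<open>M\<close>, whose image under \<open>\<psi>\<close> determines \<open>\<psi> m\<close> from \<open>\<psi> m'\<close>.\<close>

lemma linear_on_submodule_is_multiplication:
  assumes M: "\<And>x y. x \<in> M \<Longrightarrow> y \<in> M \<Longrightarrow> x + y \<in> M" "\<And>a x. a \<in> C \<Longrightarrow> x \<in> M \<Longrightarrow> a * x \<in> M"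
    and add: "\<And>x y. x \<in> M \<Longrightarrow> y \<in> M \<Longrightarrow> \<psi> (x + y) = \<psi> x + \<psi> y"
    and mult: "\<And>a x. a \<in> C \<Longrightarrow> x \<in> M \<Longrightarrow> \<psi> (a * x) = a * \<psi> x"
  obtains z where "\<And>m. m \<in> M \<Longrightarrow> \<psi> m = z * m"
proof (cases "\<exists>m\<in>M. m \<noteq> 0")
  case False
  have "\<psi> m = 0 * m" if "m \<in> M" for m
    using mult[OF zero_mem that] False that by auto
  thus ?thesis using that by blast
next
  case True
  then obtain m' where m': "m' \<in> M" "m' \<noteq> 0" by blast
  have "\<psi> m = \<psi> m' / m' * m" if m: "m \<in> M" for m
  proof -
    obtain u v n where uvn: "u \<in> C" "v \<in> C" "n \<in> C" "n \<noteq> 0" "n * (m / m') + v = u"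
      using fraction by blast
    have "u * m' = n * m + v * m'"
      using m'(2) by (simp add: uvn(5)[symmetric] distrib_right)
    hence "u * \<psi> m' = n * \<psi> m + v * \<psi> m'"
      using mult[OF uvn(1) m'(1)] mult[OF uvn(2) m'(1)] mult[OF uvn(3) m]
        add[OF M(2)[OF uvn(3) m] M(2)[OF uvn(2) m'(1)]] by simp
    moreover have "u * \<psi> m' = n * (\<psi> m' / m' * m) + v * \<psi> m'"
      by (simp add: uvn(5)[symmetric] distrib_right)
    ultimately have "n * \<psi> m = n * (\<psi> m' / m' * m)" by simp
    thus ?thesis by (rule mult_left_cancel[OF uvn(4), THEN iffD1])
  qed
  thus ?thesis using that by blast
qed

text \<open>The previous lemma, applied to the image of \<open>f\<close> and the map \<open>\<phi> \<circ> f\<^sup>-\<^sup>1\<close> on it.\<close>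

lemma functional_is_multiplication:
  assumes L: "semimodule scalars L" and f: "f \<in> functionals L" "inj_on f (carrier L)"
    and \<phi>: "\<phi> \<in> functionals L"
  obtains z where "\<And>x. x \<in> carrier L \<Longrightarrow> \<phi> x = z * f x"
proof -
  interpret semimodule scalars L by fact
  let ?g = "inv_into (carrier L) f"
  have g: "?g (f x) = x" if "x \<in> carrier L" for x using f(2) that by simp
  have gadd: "?g (m + m') = ?g m \<oplus>\<^bsub>L\<^esub> ?g m'" if m: "m \<in> f ` carrier L" and m': "m' \<in> f ` carrier L" for m m'
  proof -
    obtain x where x: "x \<in> carrier L" "m = f x" using m by blast
    obtain y where y: "y \<in> carrier L" "m' = f y" using m' by blast
    have "m + m' = f (x \<oplus>\<^bsub>L\<^esub> y)"
      unfolding x(2) y(2) by (rule functional_add[OF f(1) x(1) y(1), symmetric])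
    thus ?thesis using g[OF M.a_closed[OF x(1) y(1)]] g[OF x(1)] g[OF y(1)] x(2) y(2) by simp
  qed
  have gmult: "?g (a * m) = a \<odot>\<^bsub>L\<^esub> ?g m" if m: "m \<in> f ` carrier L" and a: "a \<in> C" for a m
  proof -
    obtain x where x: "x \<in> carrier L" "m = f x" using m by blast
    have "a * m = f (a \<odot>\<^bsub>L\<^esub> x)"
      unfolding x(2) by (rule functional_smult[OF f(1) a x(1), symmetric])
    moreover have "a \<odot>\<^bsub>L\<^esub> x \<in> carrier L" using smult_closed[of a x] x(1) a by simp
    ultimately show ?thesis using g[of "a \<odot>\<^bsub>L\<^esub> x"] g[OF x(1)] x(2) by simp
  qed
  have gc: "?g m \<in> carrier L" if "m \<in> f ` carrier L" for m
    using that by (rule inv_into_into)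
  obtain z where z: "\<And>m. m \<in> f ` carrier L \<Longrightarrow> \<phi> (?g m) = z * m"
  proof (rule linear_on_submodule_is_multiplication[of "f ` carrier L" "\<lambda>m. \<phi> (?g m)"])
    show "\<phi> (?g (m + m')) = \<phi> (?g m) + \<phi> (?g m')"
      if "m \<in> f ` carrier L" "m' \<in> f ` carrier L" for m m'
      unfolding gadd[OF that] by (rule functional_add[OF \<phi> gc[OF that(1)] gc[OF that(2)]])
    show "\<phi> (?g (a * m)) = a * \<phi> (?g m)" if "a \<in> C" "m \<in> f ` carrier L" for a m
      unfolding gmult[OF that(2,1)] by (rule functional_smult[OF \<phi> that(1) gc[OF that(2)]])
  qed (use functional_range_closed[OF L f(1)] in auto)
  show ?thesis
    by (rule that[of z]) (use z g in force)
qed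

lemma multiple_in_dual:
  assumes "f \<in> functionals L" "semimodule scalars L" "\<And>x. x \<in> carrier L \<Longrightarrow> y * f x \<in> C"
  shows "(\<lambda>x\<in>carrier L. y * f x) \<in> carrier (dual scalars L)"
proof -
  interpret semimodule scalars L by fact
  have "a \<odot>\<^bsub>L\<^esub> x \<in> carrier L" if "a \<in> C" "x \<in> carrier L" for a x
    using smult_closed[of a x] that by simp
  thus ?thesis
    using assms(1,3) unfolding carrier_dual functionals_iff
    by (auto simp: distrib_left mult.left_commute)
qed

lemma dual_ops:
  fixes L :: "('f, 'b) module"
  shows dual_add: "\<phi> \<oplus>\<^bsub>dual scalars L\<^esub> \<chi> = (\<lambda>x\<in>carrier L. \<phi> x + \<chi> x)"
    and dual_smult: "a \<odot>\<^bsub>dual scalars L\<^esub> \<chi> = (\<lambda>x\<in>carrier L. a * \<chi> x)"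
  by (simp_all add: dual_def)

lemma dual_apply:
  fixes L :: "('f, 'b) module"
  assumes "x \<in> carrier L"
  shows "(\<phi> \<oplus>\<^bsub>dual scalars L\<^esub> \<chi>) x = \<phi> x + \<chi> x" "(a \<odot>\<^bsub>dual scalars L\<^esub> \<chi>) x = a * \<chi> x"
  using assms by (simp_all add: dual_ops)

lemma dual_closed:
  fixes L :: "('f, 'b) module"
  assumes L: "semimodule scalars L" and \<phi>: "\<phi> \<in> carrier (dual scalars L)"
  shows "\<chi> \<in> carrier (dual scalars L) \<Longrightarrow> \<phi> \<oplus>\<^bsub>dual scalars L\<^esub> \<chi> \<in> carrier (dual scalars L)"
    and "a \<in> C \<Longrightarrow> a \<odot>\<^bsub>dual scalars L\<^esub> \<phi> \<in> carrier (dual scalars L)"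
proof -
  interpret semimodule scalars L by fact
  have sm: "a \<odot>\<^bsub>L\<^esub> x \<in> carrier L" if "a \<in> C" "x \<in> carrier L" for a x
    using smult_closed[of a x] that by simp
  show "\<phi> \<oplus>\<^bsub>dual scalars L\<^esub> \<chi> \<in> carrier (dual scalars L)" if \<chi>: "\<chi> \<in> carrier (dual scalars L)"
    using \<phi> \<chi> unfolding carrier_dual dual_add
    by (auto simp: functionals_iff add_mem sm distrib_left)
  show "a \<odot>\<^bsub>dual scalars L\<^esub> \<phi> \<in> carrier (dual scalars L)" if a: "a \<in> C"
    using \<phi> a unfolding carrier_dual dual_smult
    by (auto simp: functionals_iff mult_mem sm distrib_left mult.left_commute)
qed

text \<open>The functionals on \<open>L\<close> are parametrised by the submodule \<open>{y. y f(L) \<subseteq> C}\<close> of the field, so a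
  functional on the dual is again a multiplication.\<close>

lemma double_dual_elem:
  assumes L: "semimodule scalars L" and f: "f \<in> functionals L" "inj_on f (carrier L)"
    and \<Psi>: "\<Psi> \<in> carrier (dual scalars (dual scalars L))"
  obtains z where
    "\<And>y. (\<And>x. x \<in> carrier L \<Longrightarrow> y * f x \<in> C) \<Longrightarrow> \<Psi> (\<lambda>x\<in>carrier L. y * f x) = z * y"
    "\<And>y. (\<And>x. x \<in> carrier L \<Longrightarrow> y * f x \<in> C) \<Longrightarrow> z * y \<in> C"
proof -
  let ?M = "{y. \<forall>x\<in>carrier L. y * f x \<in> C}"
  let ?m = "\<lambda>y. \<lambda>x\<in>carrier L. y * f x"
  have m: "?m y \<in> carrier (dual scalars L)" if "y \<in> ?M" for y
    using multiple_in_dual[OF f(1) L] that by blast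
  have madd: "?m (y + y') = ?m y \<oplus>\<^bsub>dual scalars L\<^esub> ?m y'" and mmult: "?m (a * y) = a \<odot>\<^bsub>dual scalars L\<^esub> ?m y"
    for a y y' by (auto simp: dual_ops distrib_right mult.assoc)
  have \<Psi>': "\<Psi> \<in> functionals (dual scalars L)" "\<And>\<chi>. \<chi> \<in> carrier (dual scalars L) \<Longrightarrow> \<Psi> \<chi> \<in> C"
    using \<Psi> unfolding carrier_dual[of "dual scalars L"] by auto
  obtain z where z: "\<And>y. y \<in> ?M \<Longrightarrow> \<Psi> (?m y) = z * y"
  proof (rule linear_on_submodule_is_multiplication[of ?M "\<lambda>y. \<Psi> (?m y)"])
    show "\<Psi> (?m (y + y')) = \<Psi> (?m y) + \<Psi> (?m y')" if "y \<in> ?M" "y' \<in> ?M" for y y'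
      using \<Psi>'(1) m[OF that(1)] m[OF that(2)] unfolding functionals_iff madd by blast
    show "\<Psi> (?m (a * y)) = a * \<Psi> (?m y)" if "a \<in> C" "y \<in> ?M" for a y
      using \<Psi>'(1) m[OF that(2)] that(1) unfolding functionals_iff mmult by blast
  qed (auto simp: distrib_right add_mem mult_mem mult.assoc)
  show ?thesis
  proof (rule that[of z])
    fix y assume y: "\<And>x. x \<in> carrier L \<Longrightarrow> y * f x \<in> C"
    thus *: "\<Psi> (?m y) = z * y" using z by blast
    show "z * y \<in> C" unfolding *[symmetric] using \<Psi>'(2) m y by blast
  qed
qed

text \<open>With \<open>M\<close> the image of \<open>f\<close> and \<open>M' = {y. y M \<subseteq> C}\<close>, the criterion reads \<open>M'' \<subseteq> M\<close>: the double dual of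
  \<open>L\<close> is identified with \<open>M''\<close>, and the canonical map with \<open>f\<close>. The elements \<open>y0\<close> and \<open>x0\<close> ensure that
  \<open>M'\<close> and \<open>M\<close> are nonzero, so that a multiplier is determined by the functional that it induces.\<close>

lemma reflexive_iff:
  assumes L: "semimodule scalars L" and f: "f \<in> functionals L" "inj_on f (carrier L)"
    and y0: "y0 \<noteq> 0" "\<And>x. x \<in> carrier L \<Longrightarrow> y0 * f x \<in> C"
    and x0: "x0 \<in> carrier L" "f x0 \<noteq> 0"
  shows "reflexive scalars L \<longleftrightarrow>
    (\<forall>z. (\<forall>y. (\<forall>x\<in>carrier L. y * f x \<in> C) \<longrightarrow> z * y \<in> C) \<longrightarrow> z \<in> f ` carrier L)"
    (is "_ \<longleftrightarrow> ?D")
proof -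
  interpret semimodule scalars L by fact
  let ?ev = "\<lambda>x. \<lambda>\<chi>\<in>carrier (dual scalars L). \<chi> x"
  let ?m = "\<lambda>y. \<lambda>x\<in>carrier L. y * f x"
  have sm: "a \<odot>\<^bsub>L\<^esub> x \<in> carrier L" if "a \<in> C" "x \<in> carrier L" for a x
    using smult_closed[of a x] that by simp
  have m: "?m y \<in> carrier (dual scalars L)" if "\<forall>x\<in>carrier L. y * f x \<in> C" for y
    using multiple_in_dual[OF f(1) L] that by blast
  have evD: "?ev x \<in> carrier (dual scalars (dual scalars L))" if "x \<in> carrier L" for x
    unfolding carrier_dual[of "dual scalars L"] functionals_iff
    using that by (auto simp: dual_closed[OF L] dual_apply) (auto simp: carrier_dual)
  have ev_hom: "?ev \<in> LinearCombinations.module_hom scalars L (dual scalars (dual scalars L))"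
    unfolding LinearCombinations.module_hom_def
    using evD sm by (auto simp: dual_ops carrier_dual[of L] functionals_iff)
  have ev_inj: "inj_on ?ev (carrier L)"
  proof (rule inj_onI)
    fix x x' assume x: "x \<in> carrier L" "x' \<in> carrier L" "?ev x = ?ev x'"
    have "?ev x (?m y0) = ?ev x' (?m y0)" using x(3) by simp
    hence "y0 * f x = y0 * f x'" using m[of y0] y0(2) x(1,2) by simp
    thus "x = x'" using y0(1) f(2) x(1,2) by (auto dest: inj_onD)
  qed
  have dual_mult: "\<exists>y. \<chi> = ?m y \<and> (\<forall>x\<in>carrier L. y * f x \<in> C)" if "\<chi> \<in> carrier (dual scalars L)" for \<chi>
  proof -
    obtain y where y: "\<And>x. x \<in> carrier L \<Longrightarrow> \<chi> x = y * f x"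
      using functional_is_multiplication[OF L f, of \<chi>] \<open>\<chi> \<in> _\<close> unfolding carrier_dual by blast
    have "\<chi> = ?m y"
      using \<open>\<chi> \<in> _\<close> y unfolding carrier_dual by (intro extensionalityI[of _ "carrier L"]) auto
    moreover have "\<forall>x\<in>carrier L. y * f x \<in> C"
      using \<open>\<chi> \<in> _\<close> y unfolding carrier_dual by auto
    ultimately show ?thesis by blast
  qed
  have "reflexive scalars L \<longleftrightarrow> ?ev ` carrier L = carrier (dual scalars (dual scalars L))"
    using ev_hom ev_inj unfolding reflexive_def module_isos_def bij_betw_def by blast
  also have "\<dots> \<longleftrightarrow> ?D"
  proof
    assume surj: "?ev ` carrier L = carrier (dual scalars (dual scalars L))"
    show ?D
    proof (intro allI impI)
      fix z assume z: "\<forall>y. (\<forall>x\<in>carrier L. y * f x \<in> C) \<longrightarrow> z * y \<in> C"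
      show "z \<in> f ` carrier L"
      proof -
        let ?\<Psi> = "\<lambda>\<chi>\<in>carrier (dual scalars L). z * (\<chi> x0 / f x0)"
        have "z * (\<chi> x0 / f x0) \<in> C" if "\<chi> \<in> carrier (dual scalars L)" for \<chi>
          using dual_mult[OF that] x0 z by fastforce
        hence "?\<Psi> \<in> carrier (dual scalars (dual scalars L))"
          unfolding carrier_dual[of "dual scalars L"] functionals_iff using x0(1)
          by (auto simp: dual_closed[OF L] dual_apply algebra_simps add_divide_distrib)
        then obtain x where x: "x \<in> carrier L" "?\<Psi> = ?ev x" using surj by blast
        have "?\<Psi> (?m y0) = ?ev x (?m y0)" by (rule fun_cong[OF x(2)])
        moreover have "?m y0 \<in> carrier (dual scalars L)" using m y0(2) by blast
        ultimately have "z * y0 = y0 * f x" using x0 x(1) by simp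
        thus ?thesis using y0(1) x(1) by auto
      qed
    qed
  next
    assume D: ?D
    have "\<Psi> \<in> ?ev ` carrier L" if \<Psi>: "\<Psi> \<in> carrier (dual scalars (dual scalars L))" for \<Psi>
    proof -
      obtain z where z:
        "\<And>y. (\<And>x. x \<in> carrier L \<Longrightarrow> y * f x \<in> C) \<Longrightarrow> \<Psi> (?m y) = z * y"
        "\<And>y. (\<And>x. x \<in> carrier L \<Longrightarrow> y * f x \<in> C) \<Longrightarrow> z * y \<in> C"
        using double_dual_elem[OF L f \<Psi>] by metis
      have "z \<in> f ` carrier L" using D z(2) by blast
      then obtain x where x: "x \<in> carrier L" "z = f x" by blast
      have "\<Psi> = ?ev x"
      proof (rule extensionalityI[of _ "carrier (dual scalars L)"])
        fix \<chi> assume "\<chi> \<in> carrier (dual scalars L)"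
        then obtain y where y: "\<chi> = ?m y" "\<forall>x\<in>carrier L. y * f x \<in> C" using dual_mult by blast
        show "\<Psi> \<chi> = ?ev x \<chi>" using z(1)[of y] y x \<open>\<chi> \<in> _\<close> by (simp add: mult.commute)
      qed (use \<Psi> in \<open>auto simp: carrier_dual[of "dual scalars L"]\<close>)
      thus ?thesis using x(1) by blast
    qed
    thus "?ev ` carrier L = carrier (dual scalars (dual scalars L))" using evD by blast
  qed
  finally show ?thesis .
qed

end

section \<open>Base change to the field\<close>

context fraction_subsemiring
begin

abbreviation K :: "('f, 'f) module" where "K \<equiv> regular_module class_ring"

abbreviation tensor_eqv :: "('f, 'b) module \<Rightarrow> ('f \<times> 'b) multiset \<Rightarrow> ('f \<times> 'b) multiset \<Rightarrow> bool" where
  "tensor_eqv L \<equiv> tensor_eq scalars K L"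

lemma K_simps [simp]:
  "carrier K = UNIV" "Ring.add K = (+)" "Module.smult K = (*)" "Ring.zero K = 0"
  by (simp_all add: regular_module_def)

text \<open>The value, on the tensor represented by \<open>X\<close>, of the \<open>F\<close>-linear extension of \<open>\<phi>\<close> to \<open>F \<otimes> L\<close>.\<close>

definition extend :: "('b \<Rightarrow> 'f) \<Rightarrow> ('f \<times> 'b) multiset \<Rightarrow> 'f" where
  "extend \<phi> X = (\<Sum>(q, l)\<in>#X. q * \<phi> l)"

lemma extend_simps [simp]:
  "extend \<phi> {#} = 0" "extend \<phi> (add_mset (q, l) X) = q * \<phi> l + extend \<phi> X"
  "extend \<phi> (X + Y) = extend \<phi> X + extend \<phi> Y"
  by (simp_all add: extend_def)

lemma extend_scale: "extend \<phi> (image_mset (\<lambda>(q, l). (a * q, l)) X) = a * extend \<phi> X"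
  by (induction X) (auto simp: algebra_simps)

lemma tensor_eq_supported:
  assumes L: "semimodule scalars L" and "tensor_eqv L X Y"
  shows "set_mset X \<subseteq> UNIV \<times> carrier L \<and> set_mset Y \<subseteq> UNIV \<times> carrier L"
proof -
  interpret semimodule scalars L by fact
  show ?thesis
    using assms(2)
    by induction (use M.a_closed M.zero_closed smult_closed in auto)
qed

lemma extend_tensor_eq:
  assumes L: "semimodule scalars L" and \<phi>: "\<phi> \<in> functionals L" and "tensor_eqv L X Y"
  shows "extend \<phi> X = extend \<phi> Y"
  using assms(3)
proof induction
  case (zero_right m)
  show ?case using functional_zero[OF L \<phi>] by simp
qed (use \<phi> in \<open>auto simp: functionals_iff algebra_simps\<close>)

text \<open>If \<open>f l / f l0 = (u - v) / n\<close>, then \<open>n l + v l0 = u l0\<close> in \<open>L\<close> by injectivity of \<open>f\<close>. Tensoring with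
  \<open>p = q / n\<close> and moving scalars to the left gives \<open>q \<otimes> l + v p \<otimes> l0 = u p \<otimes> l0\<close>; then \<open>- v p \<otimes> l0\<close>
  is added on both sides.\<close>

lemma tensor_eq_pure:
  assumes L: "semimodule scalars L" and f: "f \<in> functionals L" "inj_on f (carrier L)"
    and l0: "l0 \<in> carrier L" "f l0 \<noteq> 0" and l: "l \<in> carrier L"
  shows "tensor_eqv L {#(q, l)#} {#(q * f l / f l0, l0)#}"
proof -
  interpret semimodule scalars L by fact
  note [trans] = tensor_eq.trans
  obtain u v n where uvn: "u \<in> C" "v \<in> C" "n \<in> C" "n \<noteq> 0" "n * (f l / f l0) + v = u"
    using fraction by blast
  have cl: "a \<odot>\<^bsub>L\<^esub> x \<in> carrier L" if "a \<in> C" "x \<in> carrier L" for a x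
    using smult_closed[of a x] that by simp
  have "f (n \<odot>\<^bsub>L\<^esub> l \<oplus>\<^bsub>L\<^esub> v \<odot>\<^bsub>L\<^esub> l0) = f (u \<odot>\<^bsub>L\<^esub> l0)"
    using f(1) cl[OF uvn(3) l] cl[OF uvn(2) l0(1)] uvn l l0
    unfolding functionals_iff by (simp add: uvn(5)[symmetric] distrib_right)
  hence rel: "n \<odot>\<^bsub>L\<^esub> l \<oplus>\<^bsub>L\<^esub> v \<odot>\<^bsub>L\<^esub> l0 = u \<odot>\<^bsub>L\<^esub> l0"
    using f(2) cl uvn l l0(1) by (auto dest!: inj_onD)
  define p where "p = q / n"
  have bal: "tensor_eqv L {#(a * r, x)#} {#(r, a \<odot>\<^bsub>L\<^esub> x)#}" if "a \<in> C" "x \<in> carrier L" for a r x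
    using tensor_eq.balanced[of a scalars r K x L] that by simp
  have rfl: "tensor_eqv L {#(r, x)#} {#(r, x)#}" if "x \<in> carrier L" for r x
    by (rule tensor_eq.refl) (simp add: that)
  have addl: "tensor_eqv L {#(r + s, x)#} {#(r, x), (s, x)#}" if "x \<in> carrier L" for r s x
    using tensor_eq.add_left[of r K s x L scalars] that by simp
  have 1: "tensor_eqv L ({#(q, l)#} + {#(v * p, l0)#}) {#(u * p, l0)#}"
  proof -
    have "tensor_eqv L ({#(n * p, l)#} + {#(v * p, l0)#})
        ({#(p, n \<odot>\<^bsub>L\<^esub> l)#} + {#(p, v \<odot>\<^bsub>L\<^esub> l0)#})"
      by (intro tensor_eq.plus bal uvn l l0)
    also have "tensor_eqv L \<dots> {#(p, u \<odot>\<^bsub>L\<^esub> l0)#}"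
      using tensor_eq.sym[OF tensor_eq.add_right[of p K "n \<odot>\<^bsub>L\<^esub> l" L "v \<odot>\<^bsub>L\<^esub> l0" scalars]]
        cl[OF uvn(3) l] cl[OF uvn(2) l0(1)] rel by (simp add: add_mset_commute)
    also have "tensor_eqv L \<dots> {#(u * p, l0)#}"
      by (intro tensor_eq.sym[OF bal] uvn l0)
    finally show ?thesis using uvn(4) by (simp add: p_def)
  qed
  have "tensor_eqv L ({#(q, l)#} + {#}) ({#(q, l)#} + {#(v * p + - (v * p), l0)#})"
    using tensor_eq.sym[OF tensor_eq.zero_left[of l0 L scalars K]] l0(1)
    by (intro tensor_eq.plus rfl l) simp
  also have "tensor_eqv L \<dots> ({#(q, l)#} + {#(v * p, l0), (- (v * p), l0)#})"
    by (intro tensor_eq.plus rfl addl l l0)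
  also have "{#(q, l)#} + {#(v * p, l0), (- (v * p), l0)#} =
      ({#(q, l)#} + {#(v * p, l0)#}) + {#(- (v * p), l0)#}" by simp
  also have "tensor_eqv L \<dots> ({#(u * p, l0)#} + {#(- (v * p), l0)#})"
    by (intro tensor_eq.plus 1 rfl l0)
  also have "{#(u * p, l0)#} + {#(- (v * p), l0)#} = {#(u * p, l0), (- (v * p), l0)#}"
    by (simp add: add_mset_commute)
  also have "tensor_eqv L \<dots> {#(u * p + - (v * p), l0)#}"
    by (intro tensor_eq.sym[OF addl] l0)
  also have "u * p + - (v * p) = q * f l / f l0"
    using uvn(4) by (simp add: uvn(5)[symmetric] p_def field_simps l0(2))
  finally show ?thesis by simp
qed

lemma tensor_eq_normal_form:
  assumes L: "semimodule scalars L" and f: "f \<in> functionals L" "inj_on f (carrier L)"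
    and l0: "l0 \<in> carrier L" "f l0 \<noteq> 0" and "set_mset X \<subseteq> UNIV \<times> carrier L"
  shows "tensor_eqv L X {#(extend f X / f l0, l0)#}"
  using assms(6)
proof (induction X)
  case empty
  show ?case using tensor_eq.sym[OF tensor_eq.zero_left[of l0 L scalars K]] l0(1) by simp
next
  case (add x X)
  note [trans] = tensor_eq.trans
  obtain q l where x: "x = (q, l)" "l \<in> carrier L" using add.prems by auto
  have "tensor_eqv L ({#x#} + X) ({#(q * f l / f l0, l0)#} + {#(extend f X / f l0, l0)#})"
    unfolding x(1) using add x(2) by (intro tensor_eq.plus tensor_eq_pure[OF L f l0]) auto
  also have "{#(q * f l / f l0, l0)#} + {#(extend f X / f l0, l0)#} =
      {#(q * f l / f l0, l0), (extend f X / f l0, l0)#}" by (simp add: add_mset_commute)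
  also have "tensor_eqv L \<dots> {#(q * f l / f l0 + extend f X / f l0, l0)#}"
    using tensor_eq.sym[OF tensor_eq.add_left[of "q * f l / f l0" K "extend f X / f l0" l0 L scalars]] l0(1)
    by simp
  finally show ?case by (simp add: x(1) add_divide_distrib)
qed

lemma tensor_eq_iff:
  assumes L: "semimodule scalars L" and f: "f \<in> functionals L" "inj_on f (carrier L)"
    and l0: "l0 \<in> carrier L" "f l0 \<noteq> 0"
  shows "tensor_eqv L X Y \<longleftrightarrow> set_mset X \<subseteq> UNIV \<times> carrier L \<and> set_mset Y \<subseteq> UNIV \<times> carrier L \<and>
    extend f X = extend f Y"
proof (intro iffI conjI; (elim conjE)?)
  assume *: "set_mset X \<subseteq> UNIV \<times> carrier L" "set_mset Y \<subseteq> UNIV \<times> carrier L" "extend f X = extend f Y"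
  show "tensor_eqv L X Y"
    using tensor_eq_normal_form[OF assms *(1)] tensor_eq.sym[OF tensor_eq_normal_form[OF assms *(2)]]
      *(3) by (auto intro: tensor_eq.trans)
qed (use tensor_eq_supported[OF L] extend_tensor_eq[OF L f(1)] in auto)

text \<open>By \<open>tensor_eq_iff\<close> the classes of tensors correspond to the values of \<open>extend f\<close>, so \<open>F \<otimes> L\<close> is a copy
  of \<open>F\<close>.\<close>

lemma rank_one_if_embedded:
  assumes L: "semimodule scalars L" and f: "f \<in> functionals L" "inj_on f (carrier L)"
    and l0: "l0 \<in> carrier L" "f l0 \<noteq> 0"
  shows "rank_one scalars L"
proof -
  interpret L: semimodule scalars L by fact
  let ?F = "class_ring :: 'f ring"
  let ?T = "tensor scalars K L"
  \<comment> \<open>The tensors on which the extension of \<open>f\<close> has the value \<open>s\<close>; each such set is represented by \<open>rep s\<close>.\<close>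
  define cls where "cls = (\<lambda>s. {Y. set_mset Y \<subseteq> UNIV \<times> carrier L \<and> extend f Y = s})"
  define rep where "rep = (\<lambda>s. {#(s / f l0, l0)#})"
  have rep: "rep s \<in> cls s" for s
    using l0 by (simp add: rep_def cls_def)
  have tc: "tensor_class scalars K L X = cls (extend f X)" if "set_mset X \<subseteq> UNIV \<times> carrier L" for X
    using that by (auto simp: cls_def tensor_eq_iff[OF assms])
  have cls_inj: "cls s = cls t \<longleftrightarrow> s = t" for s t
    using rep[of s] by (auto simp: cls_def)
  have carrier: "carrier ?T = range cls"
  proof
    show "carrier ?T \<subseteq> range cls" by (auto simp: tensor_def tc)
    have "cls s \<in> carrier ?T" for s
      using tc[of "rep s"] rep[of s] by (auto simp: tensor_def cls_def image_iff)
    thus "range cls \<subseteq> carrier ?T" by blast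
  qed
  have zero: "\<zero>\<^bsub>?T\<^esub> = cls 0" using tc[of "{#}"] by (simp add: tensor_def)
  have add: "cls s \<oplus>\<^bsub>?T\<^esub> cls t = cls (s + t)" for s t
  proof -
    have "cls s \<oplus>\<^bsub>?T\<^esub> cls t = (\<Union>X\<in>cls s. \<Union>Y\<in>cls t. tensor_class scalars K L (X + Y))"
      by (simp add: tensor_def)
    also have "\<dots> = (\<Union>X\<in>cls s. \<Union>Y\<in>cls t. cls (s + t))"
    proof (intro SUP_cong refl)
      fix X Y assume "X \<in> cls s" "Y \<in> cls t"
      thus "tensor_class scalars K L (X + Y) = cls (s + t)"
        by (subst tc) (auto simp: cls_def)
    qed simp_all
    also have "\<dots> = cls (s + t)" using rep[of s] rep[of t] by blast
    finally show ?thesis .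
  qed
  have smult: "a \<odot>\<^bsub>?T\<^esub> cls s = cls (a * s)" for a s
  proof -
    have "a \<odot>\<^bsub>?T\<^esub> cls s = (\<Union>X\<in>cls s. tensor_class scalars K L (image_mset (\<lambda>(m, n). (a * m, n)) X))"
      by (simp add: tensor_def)
    also have "\<dots> = (\<Union>X\<in>cls s. cls (a * s))"
    proof (intro SUP_cong refl)
      fix X assume "X \<in> cls s"
      thus "tensor_class scalars K L (image_mset (\<lambda>(m, n). (a * m, n)) X) = cls (a * s)"
        by (subst tc) (auto simp: cls_def extend_scale)
    qed simp_all
    also have "\<dots> = cls (a * s)" using rep[of s] by blast
    finally show ?thesis .
  qed
  have "abelian_group ?T"
  proof (rule abelian_groupI)
    show "\<exists>y\<in>carrier ?T. y \<oplus>\<^bsub>?T\<^esub> x = \<zero>\<^bsub>?T\<^esub>" if x: "x \<in> carrier ?T" for x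
    proof -
      obtain s where "x = cls s" using x carrier by blast
      hence "cls (- s) \<oplus>\<^bsub>?T\<^esub> x = \<zero>\<^bsub>?T\<^esub>" by (simp add: add zero)
      thus ?thesis using carrier by blast
    qed
  qed (auto simp: carrier zero add add_ac)
  hence "Module.module ?F ?T"
    by (intro Module.module.intro class_cring.cring_axioms Module.module_axioms.intro)
       (auto simp: carrier smult add algebra_simps)
  hence vs: "vectorspace ?F ?T"
    by (simp add: vectorspace_def class_field)
  then interpret V: vectorspace ?F ?T .
  have in_carrier: "cls s \<in> carrier ?T" for s using carrier by blast
  have "cls s \<in> V.span {cls 1}" for s
  proof -
    have "V.lincomb (\<lambda>_. s) {cls 1} = cls s"
      by (simp add: V.lincomb_def in_carrier smult)
    thus ?thesis unfolding V.span_def by (intro CollectI exI[of _ "\<lambda>_. s"] exI[of _ "{cls 1}"]) auto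
  qed
  hence gen: "V.gen_set {cls 1}"
    using V.span_is_subset2[of "{cls 1}"] carrier in_carrier by auto
  have "V.dim = 1"
    using gen in_carrier[of 1] by (intro V.dim1I[of "cls 1"]) (auto simp: zero cls_inj)
  moreover have "V.fin_dim"
    unfolding V.fin_dim_def using gen in_carrier[of 1] by (intro exI[of _ "{cls 1}"]) auto
  ultimately show ?thesis using vs by (simp add: rank_one_def Let_def)
qed

text \<open>Let \<open>X0\<close> represent a generator of \<open>F \<otimes> L\<close>. Then \<open>1 \<otimes> l = c X0\<close> with \<open>c\<close> depending on \<open>l\<close>, and every functional \<open>\<phi>\<close>
  takes the value \<open>c \<phi>(X0)\<close> at \<open>l\<close>. So a nonzero functional determines \<open>c\<close>, hence the values of all functionals at \<open>l\<close>,
  hence \<open>l\<close> itself, as the canonical map to the double dual is injective.\<close>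

lemma reflexive_rank_one_embeds:
  assumes L: "semimodule scalars L" and r: "reflexive scalars L" and one: "rank_one scalars L"
  obtains \<chi> l0 where "\<chi> \<in> carrier (dual scalars L)" "inj_on \<chi> (carrier L)" "l0 \<in> carrier L" "\<chi> l0 \<noteq> 0"
proof -
  interpret L: semimodule scalars L by fact
  let ?F = "class_ring :: 'f ring"
  let ?T = "tensor scalars K L"
  have vs: "vectorspace ?F ?T" and dim: "vectorspace.dim ?F ?T = 1" and fin: "vectorspace.fin_dim ?F ?T"
    using one by (simp_all add: rank_one_def Let_def)
  interpret V: vectorspace ?F ?T by fact
  obtain G where G: "finite G" "card G = 1" "G \<subseteq> carrier ?T" "V.gen_set G"
    using fin dim LeastI_ex[of "\<lambda>n. \<exists>G. finite G \<and> card G = n \<and> G \<subseteq> carrier ?T \<and> V.gen_set G"]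
    unfolding V.fin_dim_def V.dim_def by auto
  then obtain v where v: "G = {v}" "v \<in> carrier ?T" by (auto simp: card_1_singleton_iff)
  obtain X0 where X0: "set_mset X0 \<subseteq> UNIV \<times> carrier L" "v = tensor_class scalars K L X0"
    using v(2) by (auto simp: tensor_def)
  have coord: "\<exists>c. \<forall>\<phi>\<in>functionals L. \<phi> l = c * extend \<phi> X0" if l: "l \<in> carrier L" for l
  proof -
    let ?l = "{#(1, l)#} :: ('f \<times> _) multiset"
    have "tensor_class scalars K L ?l \<in> V.span {v}"
      using G(4) l v(1) by (auto simp: tensor_def)
    then obtain a B where aB: "B \<subseteq> {v}" "tensor_class scalars K L ?l = V.lincomb a B"
      unfolding V.span_def by blast
    have refl: "?l \<in> tensor_class scalars K L ?l" using l by (auto intro: tensor_eq.refl)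
    show ?thesis
    proof (cases "B = {}")
      case True
      hence "?l \<in> tensor_class scalars K L {#}"
        using aB refl by (simp add: V.lincomb_def) (simp add: tensor_def)
      hence "extend \<phi> ?l = 0" if "\<phi> \<in> functionals L" for \<phi>
        using extend_tensor_eq[OF L that, of "{#}" ?l] by simp
      thus ?thesis by (intro exI[of _ 0]) simp
    next
      case False
      hence "B = {v}" using aB(1) by blast
      hence "?l \<in> a v \<odot>\<^bsub>?T\<^esub> v"
        using aB(2) refl v(2) by (simp add: V.lincomb_def)
      then obtain X where X: "tensor_eqv L X0 X"
        "tensor_eqv L (image_mset (\<lambda>(q, l). (a v * q, l)) X) ?l"
        by (auto simp: tensor_def X0(2))
      have "\<phi> l = a v * extend \<phi> X0" if "\<phi> \<in> functionals L" for \<phi>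
        using extend_tensor_eq[OF L that X(1)] extend_tensor_eq[OF L that X(2)]
        by (simp add: extend_scale)
      thus ?thesis by blast
    qed
  qed
  have ev_inj: "inj_on (\<lambda>x. \<lambda>\<chi>\<in>carrier (dual scalars L). \<chi> x) (carrier L)"
    using r by (simp add: reflexive_def module_isos_def bij_betw_def)
  have dual_functional: "\<chi> \<in> functionals L" if "\<chi> \<in> carrier (dual scalars L)" for \<chi>
    using that by (simp add: carrier_dual)
  have separate: "x = y" if "x \<in> carrier L" "y \<in> carrier L" "\<And>\<chi>. \<chi> \<in> carrier (dual scalars L) \<Longrightarrow> \<chi> x = \<chi> y" for x y
    using inj_onD[OF ev_inj _ that(1,2)] that(3) by (auto intro!: restrict_ext)
  have "\<exists>l0\<in>carrier L. l0 \<noteq> \<zero>\<^bsub>L\<^esub>"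
  proof (rule ccontr)
    assume triv: "\<not> (\<exists>l0\<in>carrier L. l0 \<noteq> \<zero>\<^bsub>L\<^esub>)"
    have "tensor_eqv L X {#}" if "set_mset X \<subseteq> UNIV \<times> carrier L" for X
      using that
    proof (induction X)
      case (add x X)
      have "x = (fst x, \<zero>\<^bsub>L\<^esub>)" using add.prems triv by (cases x) auto
      hence "tensor_eqv L {#x#} {#}"
        using tensor_eq.zero_right[of "fst x" K scalars L] by simp
      thus ?case using tensor_eq.plus[of scalars K L "{#x#}" "{#}" X "{#}"] add by simp
    qed (simp add: tensor_eq.refl)
    hence "tensor_eqv L X0 {#}" using X0(1) by blast
    hence "tensor_class scalars K L X0 = tensor_class scalars K L {#}"
      by (auto intro: tensor_eq.trans dest: tensor_eq.sym)
    hence "v = \<zero>\<^bsub>?T\<^esub>" using X0(2) by (simp add: tensor_def)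
    hence "V.dim = 0" using V.dim0I G(4) v(1) by blast
    thus False using dim by simp
  qed
  then obtain l0 where l0: "l0 \<in> carrier L" "l0 \<noteq> \<zero>\<^bsub>L\<^esub>" by blast
  obtain \<chi> where \<chi>: "\<chi> \<in> carrier (dual scalars L)" "\<chi> l0 \<noteq> \<chi> \<zero>\<^bsub>L\<^esub>"
    using separate[OF l0(1) L.M.zero_closed] l0(2) by blast
  have nz: "\<chi> l0 \<noteq> 0" using \<chi>(2) functional_zero[OF L dual_functional[OF \<chi>(1)]] by simp
  have "inj_on \<chi> (carrier L)"
  proof (rule inj_onI)
    fix x y assume xy: "x \<in> carrier L" "y \<in> carrier L" "\<chi> x = \<chi> y"
    obtain c d e where c: "\<And>\<phi>. \<phi> \<in> functionals L \<Longrightarrow> \<phi> x = c * extend \<phi> X0"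
      and d: "\<And>\<phi>. \<phi> \<in> functionals L \<Longrightarrow> \<phi> y = d * extend \<phi> X0"
      and e: "\<And>\<phi>. \<phi> \<in> functionals L \<Longrightarrow> \<phi> l0 = e * extend \<phi> X0"
      using coord xy(1,2) l0(1) by metis
    have "extend \<chi> X0 \<noteq> 0" using e[OF dual_functional[OF \<chi>(1)]] nz by auto
    hence "c = d" using c[of \<chi>] d[of \<chi>] xy(3) dual_functional[OF \<chi>(1)] by simp
    thus "x = y" using separate[OF xy(1,2)] c d dual_functional by simp
  qed
  thus ?thesis using that \<chi>(1) l0(1) nz by blast
qed

end

section \<open>Isomorphisms of modules over a semiring\<close>

lemma module_isos_compose:
  assumes "f \<in> module_isos R L M" "g \<in> module_isos R M N"
  shows "g \<circ> f \<in> module_isos R L N"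
  using assms unfolding module_isos_def LinearCombinations.module_hom_def
  by (auto intro: bij_betw_trans simp: Pi_iff)

lemma module_isos_inverse:
  assumes L: "semimodule R L" and f: "f \<in> module_isos R L M"
  shows "inv_into (carrier L) f \<in> module_isos R M L"
proof -
  interpret semimodule R L by fact
  let ?g = "inv_into (carrier L) f"
  have bij: "bij_betw f (carrier L) (carrier M)" and hom: "f \<in> LinearCombinations.module_hom R L M"
    using f by (auto simp: module_isos_def)
  have g: "?g y \<in> carrier L" "f (?g y) = y" if "y \<in> carrier M" for y
    using bij that by (auto simp: bij_betw_def inv_into_into f_inv_into_f)
  have gf: "?g (f x) = x" if "x \<in> carrier L" for x
    using bij that by (auto simp: bij_betw_def)
  have "?g (x \<oplus>\<^bsub>M\<^esub> y) = ?g x \<oplus>\<^bsub>L\<^esub> ?g y" if "x \<in> carrier M" "y \<in> carrier M" for x y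
    using gf[OF M.a_closed[OF g(1)[OF that(1)] g(1)[OF that(2)]]]
      LinearCombinations.module_hom_add[OF hom g(1)[OF that(1)] g(1)[OF that(2)]] g(2) that by simp
  moreover have "?g (a \<odot>\<^bsub>M\<^esub> x) = a \<odot>\<^bsub>L\<^esub> ?g x" if "a \<in> carrier R" "x \<in> carrier M" for a x
    using gf[OF smult_closed[OF that(1) g(1)[OF that(2)]]]
      LinearCombinations.module_hom_smult[OF hom that(1) g(1)[OF that(2)]] g(2) that by simp
  ultimately show ?thesis
    using g(1) bij_betw_inv_into[OF bij]
    by (auto simp: module_isos_def LinearCombinations.module_hom_def)
qed

lemma iso_class_cong:
  assumes "semimodule R M" "f \<in> module_isos R M N"
  shows "iso_class R M = iso_class R N"
  unfolding iso_class_def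
  using module_isos_compose[OF _ assms(2)] module_isos_compose[OF _ module_isos_inverse[OF assms]]
  by blast

text \<open>Isomorphism classes are formed inside a fixed universe of carriers; this moves a module into it.\<close>

lemma semimodule_transport:
  fixes R :: "'a ring" and N :: "('a, 'n) module" and g :: "'n \<Rightarrow> 'm"
  assumes N: "semimodule R N" and g: "inj_on g (carrier N)"
  obtains L :: "('a, 'm) module" and h where "semimodule R L" "h \<in> module_isos R L N"
proof -
  interpret semimodule R N by fact
  define h where "h = inv_into (carrier N) g"
  have h: "h (g x) = x" if "x \<in> carrier N" for x
    using g that by (simp add: h_def)
  define L :: "('a, 'm) module" where "L = \<lparr>carrier = g ` carrier N, monoid.mult = undefined, one = undefined,
    zero = g \<zero>\<^bsub>N\<^esub>, add = (\<lambda>x y. g (h x \<oplus>\<^bsub>N\<^esub> h y)), module.smult = (\<lambda>a x. g (a \<odot>\<^bsub>N\<^esub> h x))\<rparr>"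
  have "abelian_monoid L"
    by (rule abelian_monoidI) (auto simp: L_def h M.a_ac)
  hence "semimodule R L"
    by (intro semimodule.intro R.csemiring_axioms semimodule_axioms.intro)
       (auto simp: L_def h smult_closed smult_l_distr smult_r_distr smult_l_null smult_r_null
         smult_assoc smult_one)
  moreover have "h ` g ` carrier N = carrier N" using h by force
  hence "h \<in> module_isos R L N"
    using g by (auto simp: module_isos_def LinearCombinations.module_hom_def L_def h smult_closed
        bij_betw_def inj_on_def)
  ultimately show ?thesis using that by blast
qed

section \<open>Reflexive modules of rank 1 and ideal classes\<close>

context
  fixes S :: "('f::field_char_0 \<Rightarrow> real) set"
  assumes nf: "number_field TYPE('f)" and hom: "\<forall>\<sigma>\<in>S. field_hom \<sigma>"
begin

text \<open>Stated for \<open>\<sigma>\<close> ranging over \<open>S\<close> so that the homomorphism laws are available to the simplifier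
  without an interpretation for each place.\<close>

lemma place_simps:
  assumes "\<sigma> \<in> S"
  shows "\<sigma> 0 = 0" "\<sigma> 1 = 1" "\<sigma> (x + y) = \<sigma> x + \<sigma> y" "\<sigma> (x * y) = \<sigma> x * \<sigma> y"
    "\<sigma> (of_nat n) = of_nat n" "\<sigma> (x / y) = \<sigma> x / \<sigma> y" "\<sigma> x = 0 \<longleftrightarrow> x = 0"
proof -
  interpret field_hom \<sigma> using hom assms by blast
  show "\<sigma> 0 = 0" "\<sigma> 1 = 1" "\<sigma> (x + y) = \<sigma> x + \<sigma> y" "\<sigma> (x * y) = \<sigma> x * \<sigma> y"
    "\<sigma> (of_nat n) = of_nat n" "\<sigma> (x / y) = \<sigma> x / \<sigma> y" "\<sigma> x = 0 \<longleftrightarrow> x = 0"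
    by (simp_all add: hom_distribs)
qed

text \<open>If \<open>y = D x\<close> is an integer, then \<open>2 D x + (y\<^sup>2 + 1) = (y + 1)\<^sup>2\<close>, with squares and positive integers in
  the semiring.\<close>

lemma fraction_subsemiring_nonneg_integers:
  "fraction_subsemiring (nonneg_part S (integers_of :: 'f set))"
proof
  let ?C = "nonneg_part S (integers_of :: 'f set)"
  fix x :: 'f
  obtain D where D: "D > 0" "of_nat D * x \<in> integers_of"
    using number_field_denominator[OF nf] by metis
  let ?y = "of_nat D * x"
  have sq: "z * z \<in> ?C" if "z \<in> integers_of" for z
    using that by (simp add: nonneg_part_def integers_of_mult place_simps)
  have add: "z + w \<in> ?C" if "z \<in> ?C" "w \<in> ?C" for z w
    using that by (simp add: nonneg_part_def integers_of_add place_simps)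
  have "(?y + 1) * (?y + 1) \<in> ?C" "?y * ?y + 1 * 1 \<in> ?C"
    by (intro add sq integers_of_add integers_of_1 D(2))+
  moreover have "of_nat (2 * D) \<in> ?C"
    by (rule of_nat_in_nonneg_part[OF hom integers_of_of_nat])
  moreover have "of_nat (2 * D) \<noteq> (0 :: 'f)" using D(1) by simp
  moreover have "of_nat (2 * D) * x + (?y * ?y + 1 * 1) = (?y + 1) * (?y + 1)"
    by (simp add: algebra_simps)
  ultimately show "\<exists>u\<in>?C. \<exists>v\<in>?C. \<exists>n\<in>?C. n \<noteq> 0 \<and> n * x + v = u" by blast
qed (auto simp: nonneg_part_def integers_of_closed place_simps)

interpretation fraction_subsemiring "nonneg_part S (integers_of :: 'f set)"
  rewrites "scalars = nonneg_integers S"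
proof -
  show 1: "fraction_subsemiring (nonneg_part S (integers_of :: 'f set))"
    by (rule fraction_subsemiring_nonneg_integers)
  show "fraction_subsemiring.scalars (nonneg_part S integers_of) = nonneg_integers S"
    by (simp add: fraction_subsemiring.scalars_def[OF 1] nonneg_integers_def)
qed

abbreviation nonneg_functionals :: "('f, 'b) module \<Rightarrow> ('b \<Rightarrow> 'f) set" where
  "nonneg_functionals L \<equiv>
    LinearCombinations.module_hom (nonneg_integers S) L (regular_module class_ring)"

lemma nonneg_module_simps [simp]:
  "carrier (nonneg_module S I) = nonneg_part S I" "Ring.add (nonneg_module S I) = (+)"
  "Module.smult (nonneg_module S I) = (*)" "\<zero>\<^bsub>nonneg_module S I\<^esub> = 0"
  by (simp_all add: nonneg_module_def regular_module_def)

lemma semimodule_nonneg_module: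
  assumes I: "fractional_ideal I"
  shows "semimodule (nonneg_integers S) (nonneg_module S I)"
proof (intro semimodule.intro csemiring_scalars semimodule_axioms.intro)
  show "abelian_monoid (nonneg_module S I)"
    by (rule abelian_monoidI)
       (auto simp: nonneg_part_def place_simps fractional_idealD[OF I] add_ac)
qed (auto simp: nonneg_part_def place_simps fractional_idealD[OF I] algebra_simps)

lemma iso_nonneg_moduleD:
  assumes "f \<in> module_isos (nonneg_integers S) L (nonneg_module S I)"
  shows "f \<in> nonneg_functionals L" "inj_on f (carrier L)" "f ` carrier L = nonneg_part S I"
  using assms
  by (auto simp: module_isos_def LinearCombinations.module_hom_def bij_betw_def functionals_iff)

text \<open>Two applications of \<open>positive_dual\<close> show that the double dual of \<open>I\<^sub>+\<close> is \<open>((I\<^sup>-\<^sup>1)\<^sup>-\<^sup>1)\<^sub>+ = I\<^sub>+\<close>.\<close>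

lemma reflexive_rank_one_if_iso_nonneg_module:
  assumes I: "fractional_ideal I" and L: "semimodule (nonneg_integers S) L"
    and f: "f \<in> module_isos (nonneg_integers S) L (nonneg_module S I)"
  shows "reflexive (nonneg_integers S) L" "rank_one (nonneg_integers S) L"
proof -
  note fL = iso_nonneg_moduleD[OF f]
  have J: "fractional_ideal (ideal_inverse I)" by (rule fractional_ideal_ideal_inverse[OF I])
  obtain N where N: "N > 0" "of_nat N \<in> I" using fractional_ideal_contains_nat[OF I] .
  obtain M where M: "M > 0" "of_nat M \<in> ideal_inverse I" using fractional_ideal_contains_nat[OF J] .
  have dual: "(\<forall>x\<in>carrier L. y * f x \<in> nonneg_part S integers_of) \<longleftrightarrow> y \<in> nonneg_part S (ideal_inverse I)" for y
    using positive_dual[OF hom I] fL(3) by (auto simp: set_eq_iff) force+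
  have "of_nat N \<in> f ` carrier L" unfolding fL(3) by (rule of_nat_in_nonneg_part[OF hom N(2)])
  then obtain x0 where x0: "x0 \<in> carrier L" "f x0 \<noteq> 0" using N(1) by (metis imageE of_nat_eq_0_iff less_not_refl)
  show "rank_one (nonneg_integers S) L" by (rule rank_one_if_embedded[OF L fL(1,2) x0])
  show "reflexive (nonneg_integers S) L"
  proof (subst reflexive_iff[OF L fL(1,2), of "of_nat M" x0])
    show "of_nat M * f x \<in> nonneg_part S integers_of" if "x \<in> carrier L" for x
      using dual[of "of_nat M"] of_nat_in_nonneg_part[OF hom M(2)] that by blast
    have "z \<in> nonneg_part S I" if "\<forall>y. y \<in> nonneg_part S (ideal_inverse I) \<longrightarrow> z * y \<in> nonneg_part S integers_of" for z
      using positive_dual[OF hom J] that unfolding ideal_inverse_inverse[OF nf I] by blast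
    thus "\<forall>z. (\<forall>y. (\<forall>x\<in>carrier L. y * f x \<in> nonneg_part S integers_of) \<longrightarrow>
        z * y \<in> nonneg_part S integers_of) \<longrightarrow> z \<in> f ` carrier L"
      unfolding dual fL(3) by blast
  qed (use M(1) x0 in auto)
qed

text \<open>Embed \<open>L\<close> into the semiring by a functional \<open>\<chi>\<close>, and let \<open>M'\<close> be the dual of the image. The double
  dual is cut out by integrality conditions, which define \<open>I\<close>, and sign conditions. Because
  \<open>\<sigma> (\<chi> l0) > 0\<close>, all elements of \<open>M'\<close> are nonnegative at \<open>\<sigma>\<close>, and the sign conditions reduce to
  nonnegativity at the places of \<open>S\<close>.\<close>

lemma iso_nonneg_module_if_reflexive_rank_one:
  assumes L: "semimodule (nonneg_integers S) L" and "reflexive (nonneg_integers S) L"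
    and "rank_one (nonneg_integers S) L"
  obtains I f where "fractional_ideal I" "f \<in> module_isos (nonneg_integers S) L (nonneg_module S I)"
proof -
  let ?C = "nonneg_part S (integers_of :: 'f set)"
  obtain \<chi> l0 where \<chi>: "\<chi> \<in> carrier (dual (nonneg_integers S) L)" "inj_on \<chi> (carrier L)"
    and l0: "l0 \<in> carrier L" "\<chi> l0 \<noteq> 0"
    using reflexive_rank_one_embeds[OF assms] by metis
  have lin: "\<chi> \<in> nonneg_functionals L" and C: "\<And>x. x \<in> carrier L \<Longrightarrow> \<chi> x \<in> ?C"
    using \<chi>(1) by (auto simp: carrier_dual)
  define M' where "M' = {y. \<forall>x\<in>carrier L. y * \<chi> x \<in> ?C}"
  define I where "I = {z. \<forall>y\<in>M'. z * y \<in> integers_of}"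
  \<comment> \<open>Reflexivity, in the form that the image of \<open>\<chi>\<close> contains its double dual.\<close>
  have closed: "z \<in> \<chi> ` carrier L" if "\<And>y. y \<in> M' \<Longrightarrow> z * y \<in> ?C" for z
    using reflexive_iff[OF L lin \<chi>(2), of 1 l0] assms(2) l0 C that by (auto simp: M'_def)
  have range: "z * y \<in> ?C" if "z \<in> \<chi> ` carrier L" "y \<in> M'" for z y
    using that by (auto simp: M'_def mult.commute)
  have one: "1 \<in> M'" using C by (simp add: M'_def)
  have "\<chi> l0 \<in> I" using range l0(1) by (auto simp: I_def nonneg_part_def)
  hence "I \<noteq> {0}" using l0(2) by blast
  moreover have "\<forall>x\<in>I. 1 * x \<in> integers_of" using one by (auto simp: I_def)
  moreover have "0 \<in> I" by (simp add: I_def integers_of_0)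
  moreover have "x + y \<in> I" if "x \<in> I" "y \<in> I" for x y
    using that by (simp add: I_def distrib_right integers_of_add)
  moreover have "a * x \<in> I" if "a \<in> integers_of" "x \<in> I" for a x
    using that by (simp add: I_def mult.assoc integers_of_mult)
  ultimately have I: "fractional_ideal I"
    unfolding fractional_ideal_def using integers_of_1 zero_neq_one by metis
  have "\<chi> ` carrier L = nonneg_part S I"
  proof
    show "\<chi> ` carrier L \<subseteq> nonneg_part S I"
      using range C by (auto simp: I_def nonneg_part_def)
    show "nonneg_part S I \<subseteq> \<chi> ` carrier L"
    proof
      fix z assume z: "z \<in> nonneg_part S I"
      show "z \<in> \<chi> ` carrier L"
      proof (rule closed)
        fix y assume y: "y \<in> M'"
        have "\<sigma> (z * y) \<ge> 0" if \<sigma>: "\<sigma> \<in> S" for \<sigma>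
        proof -
          have "\<sigma> (\<chi> l0) > 0"
            using C[OF l0(1)] \<sigma> l0(2) place_simps(7)[OF \<sigma>, of "\<chi> l0"]
            by (auto simp: nonneg_part_def less_le)
          moreover have "\<sigma> y * \<sigma> (\<chi> l0) \<ge> 0"
            using y l0(1) \<sigma> by (auto simp: M'_def nonneg_part_def place_simps(4)[OF \<sigma>, symmetric])
          ultimately have "\<sigma> y \<ge> 0" by (simp add: zero_le_mult_iff)
          thus ?thesis using z \<sigma> by (simp add: nonneg_part_def place_simps)
        qed
        thus "z * y \<in> ?C" using z y by (auto simp: nonneg_part_def I_def)
      qed
    qed
  qed
  hence "\<chi> \<in> module_isos (nonneg_integers S) L (nonneg_module S I)"
    using \<chi>(2) lin
    by (auto simp: module_isos_def LinearCombinations.module_hom_def bij_betw_def functionals_iff)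
  thus ?thesis using that I by blast
qed

lemma ideal_prod_principal:
  assumes I: "fractional_ideal I"
  shows "ideal_prod class_ring ((\<lambda>x. \<beta> * x) ` integers_of) I = (\<lambda>x. \<beta> * x) ` (I :: 'f set)"
proof
  have "x \<in> (\<lambda>x. \<beta> * x) ` I" if "x \<in> ideal_prod class_ring ((\<lambda>x. \<beta> * x) ` integers_of) I" for x
    using that
  proof induction
    case (prod i j)
    then obtain a where "a \<in> integers_of" "i = \<beta> * a" by blast
    thus ?case using fractional_idealD(3)[OF I] prod(2) by (auto simp: mult.assoc)
  next
    case (sum s t)
    then obtain x y where "x \<in> I" "y \<in> I" "s = \<beta> * x" "t = \<beta> * y" by blast
    thus ?case using fractional_idealD(2)[OF I, of x y]
      by (auto simp: distrib_left[symmetric])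
  qed
  thus "ideal_prod class_ring ((\<lambda>x. \<beta> * x) ` integers_of) I \<subseteq> (\<lambda>x. \<beta> * x) ` I" by blast
  have "\<beta> * x \<in> ideal_prod class_ring ((\<lambda>x. \<beta> * x) ` integers_of) I" if "x \<in> I" for x
    using ideal_prod.prod[OF imageI[OF integers_of_1, of "\<lambda>x. \<beta> * x"] that, of class_ring] by simp
  thus "(\<lambda>x. \<beta> * x) ` I \<subseteq> ideal_prod class_ring ((\<lambda>x. \<beta> * x) ` integers_of) I" by blast
qed

lemma ideal_class_eq:
  assumes "fractional_ideal I"
  shows "ideal_class S I = {(\<lambda>x. \<beta> * x) ` I | \<beta>. \<beta> \<noteq> 0 \<and> (\<forall>\<sigma>\<in>S. \<sigma> \<beta> \<ge> 0)}"
  unfolding ideal_class_def r_coset_def principal_ideals_def ideal_group_def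
  using ideal_prod_principal[OF assms] by auto

lemma ideal_class_eq_iff:
  assumes I: "fractional_ideal I" and J: "fractional_ideal J"
  shows "ideal_class S I = ideal_class S J \<longleftrightarrow>
    (\<exists>\<beta>. \<beta> \<noteq> 0 \<and> (\<forall>\<sigma>\<in>S. \<sigma> \<beta> \<ge> 0) \<and> J = (\<lambda>x. \<beta> * x) ` I)" (is "_ \<longleftrightarrow> ?R")
proof
  assume eq: "ideal_class S I = ideal_class S J"
  have "J \<in> ideal_class S J"
    unfolding ideal_class_eq[OF J] by (intro CollectI exI[of _ 1]) (simp add: place_simps)
  thus ?R unfolding eq[symmetric] ideal_class_eq[OF I] by blast
next
  assume ?R
  then obtain \<beta> where \<beta>: "\<beta> \<noteq> 0" "\<And>\<sigma>. \<sigma> \<in> S \<Longrightarrow> \<sigma> \<beta> \<ge> 0" "J = (\<lambda>x. \<beta> * x) ` I" by blast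
  show "ideal_class S I = ideal_class S J"
    unfolding ideal_class_eq[OF I] ideal_class_eq[OF J]
  proof (intro equalityI subsetI; elim CollectE exE conjE)
    fix X \<gamma> assume "X = (\<lambda>x. \<gamma> * x) ` I" "\<gamma> \<noteq> 0" "\<forall>\<sigma>\<in>S. 0 \<le> \<sigma> \<gamma>"
    thus "X \<in> {(\<lambda>x. \<beta> * x) ` J | \<beta>. \<beta> \<noteq> 0 \<and> (\<forall>\<sigma>\<in>S. \<sigma> \<beta> \<ge> 0)}"
      using \<beta> by (intro CollectI exI[of _ "\<gamma> / \<beta>"]) (auto simp: place_simps image_image)
  next
    fix X \<gamma> assume "X = (\<lambda>x. \<gamma> * x) ` J" "\<gamma> \<noteq> 0" "\<forall>\<sigma>\<in>S. 0 \<le> \<sigma> \<gamma>"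
    thus "X \<in> {(\<lambda>x. \<beta> * x) ` I | \<beta>. \<beta> \<noteq> 0 \<and> (\<forall>\<sigma>\<in>S. \<sigma> \<beta> \<ge> 0)}"
      using \<beta> by (intro CollectI exI[of _ "\<gamma> * \<beta>"]) (auto simp: place_simps image_image mult.assoc)
  qed
qed

lemma nonneg_part_scale:
  assumes "\<beta> \<noteq> 0" "\<forall>\<sigma>\<in>S. \<sigma> \<beta> \<ge> 0"
  shows "nonneg_part S ((\<lambda>x. \<beta> * x) ` I) = (\<lambda>x. \<beta> * x) ` nonneg_part S I"
proof -
  have pos: "\<sigma> \<beta> > 0" if "\<sigma> \<in> S" for \<sigma>
    using assms that place_simps(7)[OF that, of \<beta>] by (simp add: less_le)
  have "\<sigma> (\<beta> * x) \<ge> 0 \<longleftrightarrow> \<sigma> x \<ge> 0" if "\<sigma> \<in> S" for \<sigma> x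
    using pos[OF that] by (simp add: place_simps[OF that] zero_le_mult_iff)
  thus ?thesis by (auto simp: nonneg_part_def)
qed

text \<open>An isomorphism is multiplication by some \<open>\<beta>\<close>. It carries \<open>I\<close> onto \<open>J\<close>, since these are the groups of
  differences of \<open>I\<^sub>+\<close> and \<open>J\<^sub>+\<close>.\<close>

lemma ideal_class_eq_iff_iso:
  assumes I: "fractional_ideal I" and J: "fractional_ideal J"
  shows "ideal_class S I = ideal_class S J \<longleftrightarrow>
    module_isos (nonneg_integers S) (nonneg_module S I) (nonneg_module S J) \<noteq> {}"
proof
  assume "ideal_class S I = ideal_class S J"
  then obtain \<beta> where \<beta>: "\<beta> \<noteq> 0" "\<forall>\<sigma>\<in>S. \<sigma> \<beta> \<ge> 0" "J = (\<lambda>x. \<beta> * x) ` I"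
    using ideal_class_eq_iff[OF I J] by blast
  have "(\<lambda>x. \<beta> * x) \<in> module_isos (nonneg_integers S) (nonneg_module S I) (nonneg_module S J)"
    using nonneg_part_scale[OF \<beta>(1,2), of I] \<beta>(1)
    by (auto simp: module_isos_def LinearCombinations.module_hom_def bij_betw_def \<beta>(3)
        inj_on_def algebra_simps)
  thus "module_isos (nonneg_integers S) (nonneg_module S I) (nonneg_module S J) \<noteq> {}" by blast
next
  assume "module_isos (nonneg_integers S) (nonneg_module S I) (nonneg_module S J) \<noteq> {}"
  then obtain \<phi> where \<phi>: "\<phi> \<in> module_isos (nonneg_integers S) (nonneg_module S I) (nonneg_module S J)"
    by blast
  note \<phi>' = iso_nonneg_moduleD[OF \<phi>]
  have id: "(\<lambda>x. x) \<in> nonneg_functionals (nonneg_module S I)" by (simp add: functionals_iff)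
  obtain \<beta> where \<beta>: "\<And>x. x \<in> nonneg_part S I \<Longrightarrow> \<phi> x = \<beta> * x"
    using functional_is_multiplication[OF semimodule_nonneg_module[OF I] id _ \<phi>'(1)] by auto
  have img: "nonneg_part S J = (\<lambda>x. \<beta> * x) ` nonneg_part S I"
    using \<phi>'(3) \<beta> by auto
  have "J = (\<lambda>x. \<beta> * x) ` I"
  proof (intro equalityI subsetI)
    fix y assume y: "y \<in> J"
    obtain u v where "u \<in> nonneg_part S J" "v \<in> nonneg_part S J" "y = u - v"
      using fractional_ideal_positive_difference[OF hom J y] .
    then obtain a b where ab: "a \<in> nonneg_part S I" "b \<in> nonneg_part S I" "y = \<beta> * (a - b)"
      unfolding img by (auto simp: right_diff_distrib)
    have "a - b \<in> I"
      using fractional_idealD(2)[OF I, of a "- b"] fractional_idealD(4)[OF I, of b] ab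
      by (simp add: nonneg_part_def)
    thus "y \<in> (\<lambda>x. \<beta> * x) ` I" using ab(3) by blast
  next
    fix y assume "y \<in> (\<lambda>x. \<beta> * x) ` I"
    then obtain x where x: "x \<in> I" "y = \<beta> * x" by blast
    obtain u v where uv: "u \<in> nonneg_part S I" "v \<in> nonneg_part S I" "x = u - v"
      using fractional_ideal_positive_difference[OF hom I x(1)] .
    have "\<beta> * u \<in> J" "\<beta> * v \<in> J" using img uv by (auto simp: nonneg_part_def)
    thus "y \<in> J"
      using fractional_idealD(2)[OF J, of "\<beta> * u" "- (\<beta> * v)"] fractional_idealD(4)[OF J, of "\<beta> * v"]
      by (simp add: x(2) uv(3) right_diff_distrib)
  qed
  moreover have "\<beta> \<noteq> 0"
  proof
    assume "\<beta> = 0"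
    hence "J \<subseteq> {0}" using calculation by auto
    thus False using fractional_ideal_nonzero[OF J] by blast
  qed
  moreover have "\<sigma> \<beta> \<ge> 0" if \<sigma>: "\<sigma> \<in> S" for \<sigma>
  proof -
    obtain N where N: "N > 0" "of_nat N \<in> I" using fractional_ideal_contains_nat[OF I] .
    have "\<beta> * of_nat N \<in> nonneg_part S J"
      unfolding img using of_nat_in_nonneg_part[OF hom N(2)] by blast
    hence "\<sigma> \<beta> * real N \<ge> 0" using \<sigma> by (auto simp: nonneg_part_def place_simps)
    thus ?thesis using N(1) by (simp add: zero_le_mult_iff)
  qed
  ultimately show "ideal_class S I = ideal_class S J"
    using ideal_class_eq_iff[OF I J] by blast
qed

lemma carrier_class_group:
  "carrier (class_group S) = {ideal_class S I | I. fractional_ideal I}"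
  by (auto simp: class_group_def FactGroup_def RCOSETS_def ideal_class_def ideal_group_def)

lemma Pic_refl_eq:
  assumes "infinite (UNIV :: 'm set)"
  shows "(Pic_refl (nonneg_integers S) :: ('f, 'm) module set set) =
    {iso_class (nonneg_integers S) (nonneg_module S I) | I. fractional_ideal I}"
proof (intro equalityI subsetI)
  fix X :: "('f, 'm) module set" assume "X \<in> Pic_refl (nonneg_integers S)"
  then obtain L :: "('f, 'm) module" where L: "semimodule (nonneg_integers S) L"
    "reflexive (nonneg_integers S) L" "rank_one (nonneg_integers S) L"
    and X: "X = iso_class (nonneg_integers S) L" by (auto simp: Pic_refl_def)
  obtain I f where I: "fractional_ideal I" and f: "f \<in> module_isos (nonneg_integers S) L (nonneg_module S I)"
    using iso_nonneg_module_if_reflexive_rank_one[OF L] .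
  have "X = iso_class (nonneg_integers S) (nonneg_module S I)"
    unfolding X by (rule iso_class_cong[OF L(1) f])
  thus "X \<in> {iso_class (nonneg_integers S) (nonneg_module S I) | I. fractional_ideal I}"
    using I by blast
next
  fix X :: "('f, 'm) module set"
  assume "X \<in> {iso_class (nonneg_integers S) (nonneg_module S I) | I. fractional_ideal I}"
  then obtain I where I: "fractional_ideal I" "X = iso_class (nonneg_integers S) (nonneg_module S I)"
    by blast
  obtain g :: "'f \<Rightarrow> 'm" where g: "inj g"
    using number_field_embeds_in_infinite[OF nf assms] .
  obtain L :: "('f, 'm) module" and h where L: "semimodule (nonneg_integers S) L"
    and h: "h \<in> module_isos (nonneg_integers S) L (nonneg_module S I)"
    using semimodule_transport[OF semimodule_nonneg_module[OF I(1)] inj_on_subset[OF g subset_UNIV]] .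
  have "X = iso_class (nonneg_integers S) L"
    unfolding I(2) by (rule iso_class_cong[OF L h, symmetric])
  thus "X \<in> Pic_refl (nonneg_integers S)"
    using L reflexive_rank_one_if_iso_nonneg_module[OF I(1) L h] by (auto simp: Pic_refl_def)
qed

text \<open>Equal isomorphism classes give isomorphic modules only because the classes are inhabited. This is
  where an infinite universe is used: the field is countable and embeds into it.\<close>

lemma iso_class_nonneg_module_eq_iff:
  assumes "infinite (UNIV :: 'm set)" and I: "fractional_ideal I" and J: "fractional_ideal J"
  shows "(iso_class (nonneg_integers S) (nonneg_module S I) :: ('f, 'm) module set) =
      iso_class (nonneg_integers S) (nonneg_module S J) \<longleftrightarrow> ideal_class S I = ideal_class S J"
    (is "?I = ?J \<longleftrightarrow> _")
proof
  assume eq: "?I = ?J"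
  obtain g :: "'f \<Rightarrow> 'm" where g: "inj g"
    using number_field_embeds_in_infinite[OF nf assms(1)] .
  obtain L :: "('f, 'm) module" and h where L: "semimodule (nonneg_integers S) L"
    and h: "h \<in> module_isos (nonneg_integers S) L (nonneg_module S I)"
    using semimodule_transport[OF semimodule_nonneg_module[OF I] inj_on_subset[OF g subset_UNIV]] .
  have "L \<in> ?I" using L h by (auto simp: iso_class_def)
  hence "L \<in> ?J" by (simp add: eq)
  then obtain k where k: "k \<in> module_isos (nonneg_integers S) L (nonneg_module S J)"
    by (auto simp: iso_class_def)
  have "k \<circ> inv_into (carrier L) h \<in> module_isos (nonneg_integers S) (nonneg_module S I) (nonneg_module S J)"
    by (rule module_isos_compose[OF module_isos_inverse[OF L h] k])
  thus "ideal_class S I = ideal_class S J" unfolding ideal_class_eq_iff_iso[OF I J] by blast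
next
  assume "ideal_class S I = ideal_class S J"
  then obtain k where "k \<in> module_isos (nonneg_integers S) (nonneg_module S I) (nonneg_module S J)"
    unfolding ideal_class_eq_iff_iso[OF I J] by blast
  thus "?I = ?J" by (rule iso_class_cong[OF semimodule_nonneg_module[OF I]])
qed

end

theorem theorem1p3:
  fixes S :: "('f::field_char_0 \<Rightarrow> real) set"
  assumes "number_field TYPE('f)"
    and "\<forall>\<sigma>\<in>S. field_hom \<sigma>"
    and "infinite (UNIV :: 'm set)"
  shows "\<exists>\<Phi> :: 'f set set \<Rightarrow> ('f, 'm) module set.
    bij_betw \<Phi> (carrier (class_group S)) (Pic_refl (nonneg_integers S)) \<and>
    (\<forall>I. fractional_ideal I \<longrightarrow>
      \<Phi> (ideal_class S I) = iso_class (nonneg_integers S) (nonneg_module S I))"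
proof -
  define \<Phi> :: "'f set set \<Rightarrow> ('f, 'm) module set" where
    "\<Phi> = (\<lambda>c. iso_class (nonneg_integers S)
      (nonneg_module S (SOME I. fractional_ideal I \<and> ideal_class S I = c)))"
  note eq_iff = iso_class_nonneg_module_eq_iff[OF assms]
  have \<Phi>: "\<Phi> (ideal_class S I) = iso_class (nonneg_integers S) (nonneg_module S I)"
    if I: "fractional_ideal I" for I
  proof -
    let ?J = "SOME J. fractional_ideal J \<and> ideal_class S J = ideal_class S I"
    have "fractional_ideal ?J \<and> ideal_class S ?J = ideal_class S I"
      by (rule someI[of _ I]) (simp add: I)
    thus ?thesis unfolding \<Phi>_def using eq_iff[of ?J I] I by blast
  qed
  have "inj_on \<Phi> (carrier (class_group S))"
    unfolding carrier_class_group[OF assms(1,2)]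
    by (rule inj_onI) (auto simp: \<Phi> eq_iff)
  moreover have "\<Phi> ` carrier (class_group S) = Pic_refl (nonneg_integers S)"
    unfolding carrier_class_group[OF assms(1,2)] Pic_refl_eq[OF assms]
    by (force simp: \<Phi> image_iff)
  ultimately show ?thesis using \<Phi> by (auto simp: bij_betw_def)
qed

end
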